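(* Let $(X,R)$ be an infinite ultrahomogeneous cyclically ordered set with the discrete topology, let $G=(\mathrm{Aut}(X,R),\tau_\partial)$ be its automorphism group with the permutation topology, and let $\beta_GX$ be the maximal equivariant compactification of the $G$-space $X$. Then $$b_rG=b_{\beta_GX}G,$$ i.e. the Roelcke compactification of $G$ and the graph compactification of $G$ corresponding to the action $G\curvearrowright\beta_GX$ are equivalent compactifications of $G$.
   Context: Cyclic orders. A cyclically ordered (c.o.) set $(X,R)$, $|X|\ge 3$, is a set with a ternary relation $R=[\cdot,\cdot,\cdot]$ satisfying: cyclicity $[a,b,c]\Rightarrow[b,c,a]$; asymmetry $[a,b,c]\Rightarrow\neg[b,a,c]$; transitivity $[a,b,c]\wedge[a,c,d]\Rightarrow[a,b,d]$; completeness: for pairwise distinct $a,b,c$ either $[a,b,c]$ or $[a,c,b]$. A tuple $(x_1,\dots,x_n)$, $n\ge3$, is a cycle, written $[x_1,\dots,x_n]$, if $[x_i,x_j,x_k]$ for all $i<j<k$; a tuple of length 1 is a cycle; a pair $(x_1,x_2)$ is a cycle if $x_1\ne x_2$. Intervals: $(a,b)=\{x: [a,x,b]\}$. $\mathrm{Aut}(X,R)$ is the group of bijections $f:X\to X$ with $[a,b,c]\iff[fa,fb,fc]$. $(X,R)$ is ultrahomogeneous if for every $n\in\mathbb N$ and any cycles $(x_1,\dots,x_n)$, $(y_1,\dots,y_n)$ in $X$ there is $g\in \mathrm{Aut}(X,R)$ with $gx_i=y_i$ for all $i$. Topology on $G$. The permutation topology $\tau_\partial$ is the topology of pointwise convergence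 for the action on the discrete space $X$ (pointwise stabilizers of finite subsets form a base at the identity). $G$ is a topological group acting continuously on $X$. Compactifications. Spaces are Tychonoff. A compactification of a space $Y$ is a compact Hausdorff space $bY$ with a dense embedding $Y\to bY$; two compactifications are equivalent (written $=$) if there is a homeomorphism between them commuting with the embeddings. A compactification $bX$ of the $G$-space $X$ is equivariant if the action of $G$ on $X$ extends to a continuous action on $bX$; $\beta_GX$ is the maximal equivariant compactification. It has the explicit description $\beta_GX=c(X\otimes_l\{-1,0,1\})$: the lexicographic product $X\otimes_l\{-1,0,1\}$ is the c.o. set obtained by replacing each $x\in X$ by three consecutive points $x^-,x,x^+$ (in this order), and $c(\cdot)$ denotes filling each gap of this c.o. set with a single point (a gap is a cut, i.e. a linear order $<$ on the set such that $u<v<w$ implies $[u,v,w]$, having neither a least nor a greatest element). The topology of $\beta_GX$ has all intervals as a base; it is compact, $X$ is embedded as the middle points $x$, and $G$ acts with $g(x^\pm)=(gx)^\pm$. Roelcke compactification. $b_rG$ is the Samuel compactification of $(G,\mathcal L\wedge\mathcal R)$, where $\mathcal L\wedge\mathcal R$ is the Roelcke uniformity (the infimum of the left and right uniformities, with a base of uniform coverings $\{OgO: g\in G\}$, $O$ a neighbourhood of the identity); equivalently, the Gelfand space of the $C^*$-algebra of bounded functions $G\to\mathbb C$ uniformly continuous for $\mathcal L\wedge\mathcal R$. Graph compactification. For a compact space $K$ with a continuous action of $G$ inducing on $G$ its topology as the compact-open topology (which holds for $K=\beta_GX$), let $CL(K\times K)$ be the set of non-empty closed subsets of $K\times K$ with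 the Vietoris topology, and let $i_K:G\to CL(K\times K)$, $i_K(g)=\Gamma(g)=\{(x,gx): x\in K\}$. Then $b_KG=\left(\overline{i_K(G)},i_K\right)$, the closure being taken in $CL(K\times K)$. *)

theory Defs
  imports "HOL-Analysis.Analysis" "HOL-Algebra.Group_Action"
begin

no_notation eq_closure_of (\<open>closure'_of\<index>\<close>)

section \<open>Cyclically ordered sets\<close>

definition cyclic_order :: "('a \<Rightarrow> 'a \<Rightarrow> 'a \<Rightarrow> bool) \<Rightarrow> bool" where
  "cyclic_order R \<longleftrightarrow>
     (finite (UNIV :: 'a set) \<longrightarrow> 3 \<le> card (UNIV :: 'a set)) \<and>
     (\<forall>a b c. R a b c \<longrightarrow> R b c a) \<and>
     (\<forall>a b c. R a b c \<longrightarrow> \<not> R b a c) \<and>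
     (\<forall>a b c d. R a b c \<and> R a c d \<longrightarrow> R a b d) \<and>
     (\<forall>a b c. a \<noteq> b \<and> b \<noteq> c \<and> a \<noteq> c \<longrightarrow> R a b c \<or> R a c b)"

definition is_cycle :: "('a \<Rightarrow> 'a \<Rightarrow> 'a \<Rightarrow> bool) \<Rightarrow> 'a list \<Rightarrow> bool" where
  "is_cycle R xs \<longleftrightarrow>
     length xs = 1 \<or>
     (length xs = 2 \<and> xs ! 0 \<noteq> xs ! 1) \<or>
     (3 \<le> length xs \<and>
      (\<forall>i j k. i < j \<and> j < k \<and> k < length xs \<longrightarrow> R (xs ! i) (xs ! j) (xs ! k)))"

definition aut_group :: "('a \<Rightarrow> 'a \<Rightarrow> 'a \<Rightarrow> bool) \<Rightarrow> ('a \<Rightarrow> 'a) monoid" where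
  "aut_group R =
     \<lparr>carrier = {f. bij f \<and> (\<forall>a b c. R a b c \<longleftrightarrow> R (f a) (f b) (f c))},
      mult = (\<circ>), one = id\<rparr>"

definition ultrahomogeneous :: "('a \<Rightarrow> 'a \<Rightarrow> 'a \<Rightarrow> bool) \<Rightarrow> bool" where
  "ultrahomogeneous R \<longleftrightarrow>
     (\<forall>xs ys. length xs = length ys \<and> is_cycle R xs \<and> is_cycle R ys \<longrightarrow>
        (\<exists>g\<in>carrier (aut_group R). map g xs = ys))"

definition permutation_topology :: "('a \<Rightarrow> 'a \<Rightarrow> 'a \<Rightarrow> bool) \<Rightarrow> ('a \<Rightarrow> 'a) topology" where
  "permutation_topology R =
     subtopology (product_topology (\<lambda>_. discrete_topology UNIV) UNIV) (carrier (aut_group R))"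


section \<open>Compactifications\<close>

definition is_compactification :: "'y topology \<Rightarrow> 'b topology \<times> ('y \<Rightarrow> 'b) \<Rightarrow> bool" where
  "is_compactification Y b \<longleftrightarrow>
     compact_space (fst b) \<and> Hausdorff_space (fst b) \<and> embedding_map Y (fst b) (snd b) \<and>
     fst b closure_of (snd b ` topspace Y) = topspace (fst b)"

definition equivalent_compactifications ::
    "'y topology \<Rightarrow> 'b topology \<times> ('y \<Rightarrow> 'b) \<Rightarrow> 'c topology \<times> ('y \<Rightarrow> 'c) \<Rightarrow> bool" where
  "equivalent_compactifications Y b c \<longleftrightarrow>
     is_compactification Y b \<and> is_compactification Y c \<and>
     (\<exists>h. homeomorphic_map (fst b) (fst c) h \<and> (\<forall>y\<in>topspace Y. h (snd b y) = snd c y))"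

definition continuous_action ::
    "('g, 'm) monoid_scheme \<Rightarrow> 'g topology \<Rightarrow> 'x topology \<Rightarrow> ('g \<Rightarrow> 'x \<Rightarrow> 'x) \<Rightarrow> bool" where
  "continuous_action G T X \<alpha> \<longleftrightarrow>
     group_action G (topspace X) \<alpha> \<and>
     continuous_map (prod_topology T X) X (\<lambda>(g, x). \<alpha> g x)"

text \<open>In \<open>is_equivariant_compactification G T Y \<alpha> b \<gamma>\<close>, \<open>\<gamma>\<close> is the continuous action on \<open>b\<close> that
  extends the action \<open>\<alpha>\<close> on \<open>Y\<close>; by density there is at most one.\<close>

definition is_equivariant_compactification ::
    "('g, 'm) monoid_scheme \<Rightarrow> 'g topology \<Rightarrow> 'y topology \<Rightarrow> ('g \<Rightarrow> 'y \<Rightarrow> 'y) \<Rightarrow>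
     'b topology \<times> ('y \<Rightarrow> 'b) \<Rightarrow> ('g \<Rightarrow> 'b \<Rightarrow> 'b) \<Rightarrow> bool" where
  "is_equivariant_compactification G T Y \<alpha> b \<gamma> \<longleftrightarrow>
     is_compactification Y b \<and> continuous_action G T (fst b) \<gamma> \<and>
     (\<forall>g\<in>carrier G. \<forall>y\<in>topspace Y. \<gamma> g (snd b y) = snd b (\<alpha> g y))"

text \<open>The competing compactifications live on the type \<^typ>\<open>'y set set\<close>. This is no restriction:
  every compactification of \<open>Y\<close> is a Hausdorff space with a dense image of \<open>Y\<close>, so it injects into
  \<^typ>\<open>'y set set\<close>. The lemma \<open>maximal_equivariant_compactificationD\<close> below makes this precise.\<close>

definition is_maximal_equivariant_compactification ::
    "('g, 'm) monoid_scheme \<Rightarrow> 'g topology \<Rightarrow> 'y topology \<Rightarrow> ('g \<Rightarrow> 'y \<Rightarrow> 'y) \<Rightarrow>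
     'b topology \<times> ('y \<Rightarrow> 'b) \<Rightarrow> ('g \<Rightarrow> 'b \<Rightarrow> 'b) \<Rightarrow> bool" where
  "is_maximal_equivariant_compactification G T Y \<alpha> b \<gamma> \<longleftrightarrow>
     is_equivariant_compactification G T Y \<alpha> b \<gamma> \<and>
     (\<forall>(c :: 'y set set topology \<times> ('y \<Rightarrow> 'y set set)) \<delta>.
        is_equivariant_compactification G T Y \<alpha> c \<delta> \<longrightarrow>
        (\<exists>p. continuous_map (fst b) (fst c) p \<and> (\<forall>y\<in>topspace Y. p (snd b y) = snd c y)))"

lemma dense_Hausdorff_injection:
  fixes d :: "'y \<Rightarrow> 'z"
  assumes "Hausdorff_space L" and dense: "L closure_of (d ` S) = topspace L"
  shows "inj_on (\<lambda>x. {A. A \<subseteq> S \<and> x \<in> L closure_of (d ` A)}) (topspace L)"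
proof (rule inj_onI, rule ccontr)
  fix x y
  assume xy: "x \<in> topspace L" "y \<in> topspace L" "x \<noteq> y"
    and eq: "{A. A \<subseteq> S \<and> x \<in> L closure_of (d ` A)} = {A. A \<subseteq> S \<and> y \<in> L closure_of (d ` A)}"
  obtain U V where UV: "openin L U" "openin L V" "x \<in> U" "y \<in> V" "U \<inter> V = {}"
    using assms(1) xy unfolding Hausdorff_space_def disjnt_def by meson
  let ?A = "{a \<in> S. d a \<in> U}"
  have "x \<in> L closure_of (d ` ?A)"
    unfolding in_closure_of
  proof (intro conjI allI impI xy)
    fix W assume "x \<in> W \<and> openin L W"
    then have "x \<in> W \<inter> U" "openin L (W \<inter> U)" using UV by auto
    moreover have "x \<in> L closure_of (d ` S)" using dense xy by simp
    ultimately obtain y where "y \<in> d ` S" "y \<in> W \<inter> U" unfolding in_closure_of by blast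
    then show "\<exists>y. y \<in> d ` ?A \<and> y \<in> W" by auto
  qed
  then have "?A \<in> {A. A \<subseteq> S \<and> x \<in> L closure_of (d ` A)}" by blast
  then have "y \<in> L closure_of (d ` ?A)" using eq by blast
  then show False using UV unfolding in_closure_of by blast
qed

lemma maximal_equivariant_compactificationD:
  fixes c :: "'z topology \<times> ('y \<Rightarrow> 'z)" and Y :: "'y topology"
  assumes max: "is_maximal_equivariant_compactification G T Y \<alpha> b \<gamma>"
    and c: "is_equivariant_compactification G T Y \<alpha> c \<delta>"
  shows "\<exists>p. continuous_map (fst b) (fst c) p \<and> (\<forall>y\<in>topspace Y. p (snd b y) = snd c y)"
proof -
  define L d where "L = fst c" and "d = snd c"
  have L: "compact_space L" "Hausdorff_space L" "embedding_map Y L d"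
    and dense: "L closure_of (d ` topspace Y) = topspace L"
    and act: "group_action G (topspace L) \<delta>"
    and cont: "continuous_map (prod_topology T L) L (\<lambda>(g, x). \<delta> g x)"
    and equi: "\<And>g y. g \<in> carrier G \<Longrightarrow> y \<in> topspace Y \<Longrightarrow> \<delta> g (d y) = d (\<alpha> g y)"
    using c unfolding is_equivariant_compactification_def is_compactification_def
      continuous_action_def L_def d_def by auto
  define j where "j = (\<lambda>x. {A. A \<subseteq> topspace Y \<and> x \<in> L closure_of (d ` A)})"
  define k where "k = inv_into (topspace L) j"
  define M where "M = pullback_topology (j ` topspace L) k L"
  have inj: "inj_on j (topspace L)"
    unfolding j_def by (rule dense_Hausdorff_injection[OF L(2) dense])
  have kj: "k (j x) = x" if "x \<in> topspace L" for x
    using that inj by (simp add: k_def)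
  have topM: "topspace M = j ` topspace L"
    unfolding M_def topspace_pullback_topology using kj by auto
  have ck: "continuous_map M L k"
    unfolding M_def using continuous_map_pullback[OF continuous_map_id] by (simp add: o_def id_def)
  have cj: "continuous_map L M j"
    unfolding M_def
  proof (rule continuous_map_pullback')
    show "continuous_map L L (k \<circ> j)"
      by (rule continuous_map_eq[OF continuous_map_id]) (simp add: kj)
  qed auto
  have hm: "homeomorphic_maps L M j k"
    unfolding homeomorphic_maps_def using cj ck kj topM by auto
  have hj: "homeomorphic_map L M j"
    by (rule homeomorphic_map_maps[THEN iffD2, OF exI, of _ _ _ k, OF hm])
  have LM: "L homeomorphic_space M"
    using hj by (rule homeomorphic_map_imp_homeomorphic_space)
  have sub: "d ` topspace Y \<subseteq> topspace L"
    using homeomorphic_imp_surjective_map[OF L(3)[unfolded embedding_map_def]]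
    unfolding topspace_subtopology by blast
  define \<delta>' where "\<delta>' = (\<lambda>g. \<lambda>z\<in>topspace M. j (\<delta> g (k z)))"
  have dL: "\<delta> g x \<in> topspace L" if "g \<in> carrier G" "x \<in> topspace L" for g x
    using group_action.element_image[OF act that refl] .
  have dj: "\<delta>' g (j x) = j (\<delta> g x)" if "x \<in> topspace L" for g x
    using that topM kj by (simp add: \<delta>'_def)
  have comp: "is_compactification Y (M, j \<circ> d)"
    unfolding is_compactification_def fst_conv snd_conv
  proof (intro conjI)
    show "compact_space M" using L(1) LM homeomorphic_compact_space by blast
    show "Hausdorff_space M" using L(2) LM homeomorphic_Hausdorff_space by blast
    show "embedding_map Y M (j \<circ> d)"
      by (rule embedding_map_compose[OF L(3)
            surjective_embedding_map[THEN iffD2, OF hj, THEN conjunct1]])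
    show "M closure_of ((j \<circ> d) ` topspace Y) = topspace M"
      using homeomorphic_map_closure_of[OF hj sub] dense topM by (simp add: image_comp)
  qed
  have "group_action G (topspace M) \<delta>'"
  proof (intro group_action.intro group_hom.intro group_hom_axioms.intro homI)
    show "group G" using act group_action.group_hom group_hom.axioms(1) by blast
    show "group (BijGroup (topspace M))" by (rule group_BijGroup)
    have bij: "\<delta>' g \<in> Bij (topspace M)" if g: "g \<in> carrier G" for g
    proof -
      have "bij_betw (\<delta> g) (topspace L) (topspace L)"
        using group_action.bij_prop0[OF act g] by (simp add: Bij_def)
      moreover have "bij_betw j (topspace L) (topspace M)"
        using inj topM by (simp add: bij_betw_def)
      moreover have "bij_betw k (topspace M) (topspace L)"
        unfolding k_def by (rule bij_betw_inv_into) fact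
      ultimately have "bij_betw (j \<circ> (\<delta> g \<circ> k)) (topspace M) (topspace M)"
        by (meson bij_betw_trans)
      moreover have "bij_betw (j \<circ> (\<delta> g \<circ> k)) (topspace M) (topspace M) =
          bij_betw (\<delta>' g) (topspace M) (topspace M)"
        by (rule bij_betw_cong) (simp add: \<delta>'_def)
      ultimately have "bij_betw (\<delta>' g) (topspace M) (topspace M)"
        by (rule iffD1[rotated])
      then show ?thesis by (simp add: Bij_def \<delta>'_def)
    qed
    show "\<delta>' g \<in> carrier (BijGroup (topspace M))" if "g \<in> carrier G" for g
      using bij[OF that] by (simp add: BijGroup_def)
    show "\<delta>' (g \<otimes>\<^bsub>G\<^esub> h) = \<delta>' g \<otimes>\<^bsub>BijGroup (topspace M)\<^esub> \<delta>' h"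
      if g: "g \<in> carrier G" and h: "h \<in> carrier G" for g h
    proof -
      have "\<delta>' (g \<otimes>\<^bsub>G\<^esub> h) = compose (topspace M) (\<delta>' g) (\<delta>' h)"
      proof
        fix z
        show "\<delta>' (g \<otimes>\<^bsub>G\<^esub> h) z = compose (topspace M) (\<delta>' g) (\<delta>' h) z"
        proof (cases "z \<in> topspace M")
          case True
          then obtain x where "x \<in> topspace L" "z = j x" using topM by auto
          then show ?thesis
            using True g h dj dL group_action.composition_rule[OF act] by (simp add: compose_def)
        qed (simp add: \<delta>'_def compose_def)
      qed
      then show ?thesis using bij g h by (simp add: BijGroup_def)
    qed
  qed
  moreover have "continuous_map (prod_topology T M) M (\<lambda>(g, z). \<delta>' g z)"
  proof (rule continuous_map_eq)
    have "continuous_map (prod_topology T M) (prod_topology T L) (\<lambda>(g, z). (g, k z))"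
      using ck continuous_map_id[unfolded id_def] by (intro continuous_map_prod_top[THEN iffD2]) blast
    from continuous_map_compose[OF continuous_map_compose[OF this cont] cj]
    show "continuous_map (prod_topology T M) M
        (j \<circ> ((\<lambda>(g, x). \<delta> g x) \<circ> (\<lambda>(g, z). (g, k z))))" .
  qed (auto simp: \<delta>'_def)
  moreover have "\<forall>g\<in>carrier G. \<forall>y\<in>topspace Y. \<delta>' g ((j \<circ> d) y) = (j \<circ> d) (\<alpha> g y)"
    using sub equi dj by auto
  ultimately have "is_equivariant_compactification G T Y \<alpha> (M, j \<circ> d) \<delta>'"
    unfolding is_equivariant_compactification_def continuous_action_def fst_conv snd_conv
    using comp by (intro conjI)
  then have "\<exists>p. continuous_map (fst b) (fst (M, j \<circ> d)) p \<and>
      (\<forall>y\<in>topspace Y. p (snd b y) = snd (M, j \<circ> d) y)"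
    using max unfolding is_maximal_equivariant_compactification_def by blast
  then obtain p where p: "continuous_map (fst b) M p" "\<forall>y\<in>topspace Y. p (snd b y) = (j \<circ> d) y"
    unfolding fst_conv snd_conv by blast
  have "continuous_map (fst b) L (k \<circ> p)"
    using p(1) ck by (rule continuous_map_compose)
  moreover have "\<forall>y\<in>topspace Y. (k \<circ> p) (snd b y) = d y"
    using p(2) sub kj by auto
  ultimately show ?thesis unfolding L_def d_def by blast
qed


section \<open>The Roelcke compactification\<close>

text \<open>A uniformity on \<open>S\<close> is represented by the filter of its entourages on \<^typ>\<open>'g \<times> 'g\<close>. The
  uniform covering with members \<open>V g V\<close> corresponds to the entourage that is the union of the
  squares of its members.\<close>

definition roelcke_uniformity :: "('g, 'm) monoid_scheme \<Rightarrow> 'g topology \<Rightarrow> ('g \<times> 'g) filter" where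
  "roelcke_uniformity G T =
     (INF V\<in>{V. openin T V \<and> \<one>\<^bsub>G\<^esub> \<in> V}.
        principal (\<Union>g\<in>carrier G. (V #>\<^bsub>G\<^esub> g <#>\<^bsub>G\<^esub> V) \<times> (V #>\<^bsub>G\<^esub> g <#>\<^bsub>G\<^esub> V)))"

text \<open>Functions on \<open>S\<close> are normalised to be \<^const>\<open>undefined\<close> outside \<open>S\<close>.\<close>

definition bounded_unif_cont :: "'g set \<Rightarrow> ('g \<times> 'g) filter \<Rightarrow> ('g \<Rightarrow> complex) set" where
  "bounded_unif_cont S U =
     {f \<in> extensional S. bounded (f ` S) \<and> filterlim (\<lambda>(x, y). (f x, f y)) uniformity U}"

definition characters :: "'g set \<Rightarrow> ('g \<Rightarrow> complex) set \<Rightarrow> (('g \<Rightarrow> complex) \<Rightarrow> complex) set" where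
  "characters S A =
     {\<phi> \<in> extensional A.
        (\<forall>f\<in>A. \<forall>g\<in>A. \<phi> (\<lambda>x\<in>S. f x + g x) = \<phi> f + \<phi> g) \<and>
        (\<forall>f\<in>A. \<forall>z. \<phi> (\<lambda>x\<in>S. z * f x) = z * \<phi> f) \<and>
        (\<forall>f\<in>A. \<forall>g\<in>A. \<phi> (\<lambda>x\<in>S. f x * g x) = \<phi> f * \<phi> g) \<and>
        (\<exists>f\<in>A. \<phi> f \<noteq> 0)}"

text \<open>The Samuel compactification as the Gelfand space of the algebra of bounded uniformly continuous
  functions; points of \<open>S\<close> are sent to their evaluations.\<close>

definition samuel_compactification ::
    "'g set \<Rightarrow> ('g \<times> 'g) filter \<Rightarrow>
     (('g \<Rightarrow> complex) \<Rightarrow> complex) topology \<times> ('g \<Rightarrow> ('g \<Rightarrow> complex) \<Rightarrow> complex)" where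
  "samuel_compactification S U =
     (let A = bounded_unif_cont S U
      in (subtopology (product_topology (\<lambda>_. euclidean) A) (characters S A),
          \<lambda>x. \<lambda>f\<in>A. f x))"

definition roelcke_compactification ::
    "('g, 'm) monoid_scheme \<Rightarrow> 'g topology \<Rightarrow>
     (('g \<Rightarrow> complex) \<Rightarrow> complex) topology \<times> ('g \<Rightarrow> ('g \<Rightarrow> complex) \<Rightarrow> complex)" where
  "roelcke_compactification G T =
     samuel_compactification (carrier G) (roelcke_uniformity G T)"


section \<open>Graph compactifications\<close>

definition nonempty_closed_sets :: "'z topology \<Rightarrow> 'z set set" where
  "nonempty_closed_sets Z = {C. closedin Z C \<and> C \<noteq> {}}"

definition vietoris_topology :: "'z topology \<Rightarrow> 'z set topology" where
  "vietoris_topology Z =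
     topology_generated_by
       ({{C \<in> nonempty_closed_sets Z. C \<subseteq> U} | U. openin Z U} \<union>
        {{C \<in> nonempty_closed_sets Z. C \<inter> U \<noteq> {}} | U. openin Z U})"

definition action_graph :: "'k topology \<Rightarrow> ('g \<Rightarrow> 'k \<Rightarrow> 'k) \<Rightarrow> 'g \<Rightarrow> ('k \<times> 'k) set" where
  "action_graph K \<gamma> g = {(x, \<gamma> g x) | x. x \<in> topspace K}"

definition graph_compactification ::
    "('g, 'm) monoid_scheme \<Rightarrow> 'k topology \<Rightarrow> ('g \<Rightarrow> 'k \<Rightarrow> 'k) \<Rightarrow>
     ('k \<times> 'k) set topology \<times> ('g \<Rightarrow> ('k \<times> 'k) set)" where
  "graph_compactification G K \<gamma> =
     (let Z = vietoris_topology (prod_topology K K)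
      in (subtopology Z (Z closure_of (action_graph K \<gamma> ` carrier G)), action_graph K \<gamma>))"

end

theory Submission
  imports Defs
begin

text \<open>
  Write \<open>V\<^sub>F\<close> for the pointwise stabilizer of a finite set \<open>F \<subseteq> X\<close>. These subgroups form a base at the
  identity of the automorphism group \<open>G\<close>, so the Roelcke uniformity is generated by the partitions of
  \<open>G\<close> into double cosets \<open>V\<^sub>F g V\<^sub>F\<close>. Let \<open>K\<close> be the maximal equivariant compactification and \<open>L\<close> the closure of
  the graphs \<open>\<Gamma>(g)\<close> in the hyperspace of \<open>K \<times> K\<close>. The theorem says that the double coset partitions and
  the Vietoris topology describe the same closeness on \<open>G\<close>; this is shown in two halves.

  Graphs depend uniformly on double cosets. The graph of \<open>v g w\<close> is the image of \<open>\<Gamma>(g)\<close> under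
  \<open>w\<^sup>-\<^sup>1 \<times> v\<close>, and the induced action of \<open>G \<times> G\<close> on the compact hyperspace is jointly continuous. By
  compactness a continuous real function on the hyperspace hardly changes when its argument is moved by
  a pair of elements of a small \<open>V\<^sub>F\<close>, so its restriction to graphs is uniformly continuous for the
  Roelcke uniformity (\<open>hyper_function_roelcke_uniformly_continuous\<close>). This half holds for every
  continuous action on a compact Hausdorff space.

  Double cosets are visible in the hyperspace. By ultrahomogeneity the double coset of \<open>g\<close> is
  determined by the cyclic order type of the pair \<open>(F, g F)\<close>, and that type can be read off from the
  answers to the questions whether \<open>g\<close> moves some point of the arc from \<open>a\<close> to \<open>b\<close> into the arc from
  \<open>c\<close> to \<open>d\<close>, with \<open>a, b, c, d \<in> F\<close> (\<open>arc_pattern_determines_double_coset\<close>). If the closures of arcs in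
  \<open>K\<close> are clopen, each answer is a clopen condition on \<open>\<Gamma>(g)\<close>, so every point of \<open>L\<close> has a
  neighbourhood that meets only the graphs of a single double coset (\<open>double_coset_neighbourhood\<close>). That arcs
  have clopen closures is the only place where the maximality of \<open>K\<close> enters: the closure of \<open>X\<close> in
  \<open>{0,1}\<^bsup>X \<times> X\<^esup>\<close>, where a point is coded by the arcs that contain it, is an equivariant compactification
  in which arcs are clopen, and \<open>K\<close> maps to it (\<open>maximal_compactification_separates_arcs\<close>).

  The two halves are combined by \<open>homeomorphic_map_samuel_compactification\<close>. The second half lets every
  Roelcke uniformly continuous function extend continuously to \<open>L\<close>, so each point of \<open>L\<close> gives a
  character of the algebra of those functions; the first half supplies enough functions to make this
  map injective; and evaluations are dense in the space of characters, which makes it surjective.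
\<close>

unbundle no m_inv_syntax

section \<open>Points of a Samuel compactification\<close>

text \<open>The images under \<open>f\<close> of the traces on \<open>S\<close> of the neighbourhoods of a point form a Cauchy filter, whose limit is
the value of the extension.\<close>

lemma continuous_map_extension_from_dense:
  fixes f :: "'s \<Rightarrow> 'c::complete_space"
  assumes dense: "L closure_of (i ` S) = topspace L"
    and osc: "\<And>C \<epsilon>. C \<in> topspace L \<Longrightarrow> 0 < \<epsilon> \<Longrightarrow>
      \<exists>N. openin L N \<and> C \<in> N \<and> (\<forall>s\<in>S. \<forall>t\<in>S. i s \<in> N \<longrightarrow> i t \<in> N \<longrightarrow> dist (f s) (f t) < \<epsilon>)"
  obtains F where "continuous_map L euclidean F" "\<And>s. s \<in> S \<Longrightarrow> i s \<in> topspace L \<Longrightarrow> F (i s) = f s"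
proof -
  define T where "T = (\<lambda>C. inf (filtercomap i (nhdsin L C)) (principal S))"
  have evT: "eventually P (T C) \<longleftrightarrow> (\<exists>N. openin L N \<and> C \<in> N \<and> (\<forall>s\<in>S. i s \<in> N \<longrightarrow> P s))"
    if "C \<in> topspace L" for P C
    using that unfolding T_def eventually_inf_principal eventually_filtercomap eventually_nhdsin
    by (auto; blast)
  have nbot: "T C \<noteq> bot" if C: "C \<in> topspace L" for C
  proof -
    have "\<exists>s\<in>S. i s \<in> N" if "openin L N" "C \<in> N" for N
      using that C dense unfolding set_eq_iff in_closure_of by blast
    then show ?thesis
      unfolding trivial_limit_def evT[OF C] by blast
  qed
  have "\<exists>l. filterlim f (nhds l) (T C)" if C: "C \<in> topspace L" for C
  proof -
    have "cauchy_filter (filtermap f (T C))"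
      unfolding cauchy_filter_metric_filtermap
    proof (intro allI impI)
      fix \<epsilon> :: real assume "0 < \<epsilon>"
      from osc[OF C this] obtain N where N: "openin L N" "C \<in> N"
        "\<forall>s\<in>S. \<forall>t\<in>S. i s \<in> N \<longrightarrow> i t \<in> N \<longrightarrow> dist (f s) (f t) < \<epsilon>" by blast
      show "\<exists>P. eventually P (T C) \<and> (\<forall>x y. P x \<and> P y \<longrightarrow> dist (f x) (f y) < \<epsilon>)"
        using N by (intro exI[of _ "\<lambda>s. s \<in> S \<and> i s \<in> N"]) (auto simp: evT[OF C])
    qed
    then obtain l where "filtermap f (T C) \<le> nhds l"
      using cauchy_filter_complete_converges[OF _ complete_UNIV, of "filtermap f (T C)"] nbot[OF C]
      by (auto simp: filtermap_bot_iff)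
    then show ?thesis unfolding filterlim_def by blast
  qed
  then obtain F where F: "\<And>C. C \<in> topspace L \<Longrightarrow> filterlim f (nhds (F C)) (T C)" by metis
  have near: "dist (F C) (f s) \<le> \<epsilon>"
    if N: "openin L N" "C \<in> N" "\<forall>s\<in>S. \<forall>t\<in>S. i s \<in> N \<longrightarrow> i t \<in> N \<longrightarrow> dist (f s) (f t) < \<epsilon>"
      and s: "s \<in> S" "i s \<in> N" for N C s \<epsilon>
  proof -
    have C: "C \<in> topspace L" using N openin_subset by blast
    have "eventually (\<lambda>t. dist (f t) (f s) \<le> \<epsilon>) (T C)"
      unfolding evT[OF C] using N s by (intro exI[of _ N]) (auto intro: less_imp_le)
    then show ?thesis
      using tendsto_upperbound[OF tendsto_dist[OF F[OF C] tendsto_const] _ nbot[OF C]] by blast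
  qed
  show thesis
  proof
    show "continuous_map L euclidean F"
      unfolding mtopology_is_euclidean[symmetric] Met_TC.continuous_map_to_metric
    proof (intro ballI allI impI)
      fix C and \<epsilon> :: real assume C: "C \<in> topspace L" and "0 < \<epsilon>"
      then have "0 < \<epsilon>/3" by simp
      from osc[OF C this] obtain N where N: "openin L N" "C \<in> N"
        "\<forall>s\<in>S. \<forall>t\<in>S. i s \<in> N \<longrightarrow> i t \<in> N \<longrightarrow> dist (f s) (f t) < \<epsilon>/3" by blast
      have "F D \<in> Met_TC.mball (F C) \<epsilon>" if D: "D \<in> N" for D
      proof -
        obtain s where s: "s \<in> S" "i s \<in> N"
          using N(1) C N(2) dense unfolding set_eq_iff in_closure_of by blast
        have "dist (F C) (F D) \<le> dist (F C) (f s) + dist (F D) (f s)"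
          by (rule dist_triangle2)
        also have "\<dots> \<le> \<epsilon>/3 + \<epsilon>/3"
          using near[OF N s] near[OF N(1) D N(3) s] by (rule add_mono)
        also have "\<dots> < \<epsilon>" using \<open>0 < \<epsilon>\<close> by simp
        finally show ?thesis by simp
      qed
      then show "\<exists>U. openin L U \<and> C \<in> U \<and> (\<forall>y\<in>U. F y \<in> Met_TC.mball (F C) \<epsilon>)"
        using N by blast
    qed
    show "F (i s) = f s" if s: "s \<in> S" "i s \<in> topspace L" for s
    proof -
      have "dist (F (i s)) (f s) \<le> 0 + \<epsilon>" if "0 < \<epsilon>" for \<epsilon>
      proof -
        from osc[OF s(2) that] obtain N where "openin L N" "i s \<in> N"
          "\<forall>s\<in>S. \<forall>t\<in>S. i s \<in> N \<longrightarrow> i t \<in> N \<longrightarrow> dist (f s) (f t) < \<epsilon>" by blast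
        from near[OF this s(1) this(2)] show ?thesis by simp
      qed
      then show ?thesis using field_le_epsilon[of "dist (F (i s)) (f s)" 0] by simp
    qed
  qed
qed

lemma mem_bounded_unif_cont_iff:
  "f \<in> bounded_unif_cont S U \<longleftrightarrow>
    f \<in> extensional S \<and> bounded (f ` S) \<and> (\<forall>\<epsilon>>0. eventually (\<lambda>(x, y). dist (f x) (f y) < \<epsilon>) U)"
  unfolding bounded_unif_cont_def uniformity_dist filterlim_INF filterlim_principal
  by (auto simp: case_prod_unfold)

text \<open>The values of bounded functions stay in a compact set, on which continuous operations are uniformly
continuous. This one fact gives closure of the algebra under sums, products, conjugation, and under
inversion of functions bounded away from \<open>0\<close>.\<close>

lemma bounded_unif_cont_comp2:
  assumes U: "U \<le> principal (S \<times> S)"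
    and f: "f \<in> bounded_unif_cont S U" and g: "g \<in> bounded_unif_cont S U"
    and K: "compact K" "\<And>x. x \<in> S \<Longrightarrow> (f x, g x) \<in> K" and \<phi>: "continuous_on K \<phi>"
  shows "(\<lambda>x\<in>S. \<phi> (f x, g x)) \<in> bounded_unif_cont S U"
  unfolding mem_bounded_unif_cont_iff
proof (intro conjI allI impI)
  have "bounded (\<phi> ` K)"
    using compact_continuous_image[OF \<phi> K(1)] by (rule compact_imp_bounded)
  then show "bounded ((\<lambda>x\<in>S. \<phi> (f x, g x)) ` S)"
    by (rule bounded_subset) (use K(2) in auto)
  fix \<epsilon> :: real assume "0 < \<epsilon>"
  then obtain \<delta> where \<delta>: "0 < \<delta>" "\<And>p q. p \<in> K \<Longrightarrow> q \<in> K \<Longrightarrow> dist q p < \<delta> \<Longrightarrow> dist (\<phi> q) (\<phi> p) < \<epsilon>"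
    using compact_uniformly_continuous[OF \<phi> K(1)] unfolding uniformly_continuous_on_def by metis
  have "eventually (\<lambda>(x, y). dist (f x) (f y) < \<delta>/2) U" "eventually (\<lambda>(x, y). dist (g x) (g y) < \<delta>/2) U"
    using f g half_gt_zero[OF \<delta>(1)] unfolding mem_bounded_unif_cont_iff by blast+
  moreover have "eventually (\<lambda>p. p \<in> S \<times> S) U"
    using U le_principal by blast
  ultimately show "eventually (\<lambda>(x, y). dist ((\<lambda>x\<in>S. \<phi> (f x, g x)) x) ((\<lambda>x\<in>S. \<phi> (f x, g x)) y) < \<epsilon>) U"
  proof eventually_elim
    case (elim p)
    obtain x y where p: "p = (x, y)" by fastforce
    have "dist (f x, g x) (f y, g y) \<le> dist (f x) (f y) + dist (g x) (g y)"
      unfolding dist_Pair_Pair by (rule sqrt_sum_squares_le_sum) auto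
    also have "\<dots> < \<delta>" using elim p by simp
    finally show ?case using \<delta>(2) K(2) elim p by auto
  qed
qed auto

lemma bounded_unif_cont_comp:
  assumes "U \<le> principal (S \<times> S)" "f \<in> bounded_unif_cont S U" "g \<in> bounded_unif_cont S U"
    and \<phi>: "continuous_on UNIV (\<lambda>(y, z). \<phi> y z)"
  shows "(\<lambda>x\<in>S. \<phi> (f x) (g x)) \<in> bounded_unif_cont S U"
proof -
  have "compact (closure (f ` S) \<times> closure (g ` S))"
    using assms(2,3) unfolding mem_bounded_unif_cont_iff by (auto intro: compact_Times)
  from bounded_unif_cont_comp2[OF assms(1-3) this _ continuous_on_subset[OF \<phi>]]
  show ?thesis using closure_subset by fastforce
qed

lemma bounded_unif_cont_const: "U \<le> principal (S \<times> S) \<Longrightarrow> (\<lambda>x\<in>S. c) \<in> bounded_unif_cont S U"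
  unfolding mem_bounded_unif_cont_iff
  by (auto simp: le_principal image_constant_conv elim!: eventually_mono)

lemma charactersD:
  assumes "\<psi> \<in> characters S A"
  shows "\<psi> \<in> extensional A"
    and "\<And>f g. f \<in> A \<Longrightarrow> g \<in> A \<Longrightarrow> \<psi> (\<lambda>x\<in>S. f x + g x) = \<psi> f + \<psi> g"
    and "\<And>f z. f \<in> A \<Longrightarrow> \<psi> (\<lambda>x\<in>S. z * f x) = z * \<psi> f"
    and "\<And>f g. f \<in> A \<Longrightarrow> g \<in> A \<Longrightarrow> \<psi> (\<lambda>x\<in>S. f x * g x) = \<psi> f * \<psi> g"
  using assms unfolding characters_def by auto

lemma character_const:
  assumes U: "U \<le> principal (S \<times> S)" and \<psi>: "\<psi> \<in> characters S (bounded_unif_cont S U)"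
  shows "\<psi> (\<lambda>x\<in>S. c) = c"
proof -
  let ?A = "bounded_unif_cont S U"
  obtain f where f: "f \<in> ?A" "\<psi> f \<noteq> 0" using \<psi> unfolding characters_def by blast
  have one: "(\<lambda>x\<in>S. 1) \<in> ?A" by (rule bounded_unif_cont_const[OF U])
  have "f = (\<lambda>x\<in>S. (\<lambda>x\<in>S. 1) x * f x)"
    using f(1) unfolding mem_bounded_unif_cont_iff by (auto simp: fun_eq_iff extensional_def)
  then have "\<psi> f = \<psi> (\<lambda>x\<in>S. 1) * \<psi> f" using charactersD(4)[OF \<psi> one f(1)] by simp
  then have "\<psi> (\<lambda>x\<in>S. 1) = 1" using f(2) by simp
  then show ?thesis using charactersD(3)[OF \<psi> one, of c]
    by (simp cong: restrict_cong)
qed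

lemma character_sum_eq_0:
  fixes u :: "'i \<Rightarrow> 's \<Rightarrow> complex"
  assumes U: "U \<le> principal (S \<times> S)" and \<psi>: "\<psi> \<in> characters S (bounded_unif_cont S U)"
    and "finite I" "\<And>j. j \<in> I \<Longrightarrow> u j \<in> bounded_unif_cont S U \<and> \<psi> (u j) = 0"
  shows "(\<lambda>x\<in>S. \<Sum>j\<in>I. u j x) \<in> bounded_unif_cont S U \<and> \<psi> (\<lambda>x\<in>S. \<Sum>j\<in>I. u j x) = 0"
  using assms(3,4)
proof (induction I rule: finite_induct)
  case empty
  then show ?case unfolding sum.empty using bounded_unif_cont_const[OF U, of 0] character_const[OF U \<psi>, of 0] by blast
next
  case (insert j I)
  let ?g = "\<lambda>x\<in>S. \<Sum>j\<in>I. u j x"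
  have g: "?g \<in> bounded_unif_cont S U" "\<psi> ?g = 0" using insert.IH insert.prems by blast+
  have u: "u j \<in> bounded_unif_cont S U" "\<psi> (u j) = 0" using insert by auto
  have eq: "(\<lambda>x\<in>S. \<Sum>j\<in>insert j I. u j x) = (\<lambda>x\<in>S. u j x + ?g x)"
    using insert(1,2) by (auto simp: fun_eq_iff)
  show ?case unfolding eq
  proof
    show "(\<lambda>x\<in>S. u j x + ?g x) \<in> bounded_unif_cont S U"
      by (rule bounded_unif_cont_comp[OF U u(1) g(1)]) (auto simp: case_prod_unfold intro!: continuous_intros)
    show "\<psi> (\<lambda>x\<in>S. u j x + ?g x) = 0"
      unfolding charactersD(2)[OF \<psi> u(1) g(1)] u(2) g(2) by simp
  qed
qed

text \<open>If \<open>\<psi>\<close> were not a limit of evaluations, then for finitely many functions \<open>f\<close> of the algebra the sum of the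
\<open>\<bar>f - \<psi> f\<bar>\<^sup>2\<close> would be bounded away from \<open>0\<close> on \<open>S\<close>, hence invertible in the algebra. But \<open>\<psi>\<close>
vanishes on it, because each summand is a multiple of \<open>f - \<psi> f\<close>.\<close>

lemma character_in_closure_of_evaluations:
  assumes U: "U \<le> principal (S \<times> S)" and "S \<noteq> {}"
    and \<psi>: "\<psi> \<in> characters S (bounded_unif_cont S U)"
  defines "A \<equiv> bounded_unif_cont S U"
  shows "\<psi> \<in> product_topology (\<lambda>_. euclidean) A closure_of ((\<lambda>x. \<lambda>f\<in>A. f x) ` S)"
  unfolding in_closure_of
proof (intro conjI allI impI)
  have \<psi>': "\<psi> \<in> characters S A" using \<psi> by (simp add: A_def)
  show "\<psi> \<in> topspace (product_topology (\<lambda>_. euclidean) A)"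
    using charactersD(1)[OF \<psi>'] by (simp add: PiE_def)
  fix W assume W: "\<psi> \<in> W \<and> openin (product_topology (\<lambda>_. euclidean) A) W"
  then obtain X where X: "\<psi> \<in> (\<Pi>\<^sub>E f\<in>A. X f)" "\<And>f. open (X f)" "finite {f. X f \<noteq> UNIV}"
      "(\<Pi>\<^sub>E f\<in>A. X f) \<subseteq> W"
    using product_topology_open_contains_basis[of "\<lambda>_. euclidean" A W \<psi>]
    unfolding topspace_euclidean open_openin[symmetric] by blast
  define I where "I = {f \<in> A. X f \<noteq> UNIV}"
  have "finite I" using X(3) by (rule rev_finite_subset) (auto simp: I_def)
  have "\<exists>r>0. ball (\<psi> f) r \<subseteq> X f" if "f \<in> A" for f
    using X(2)[of f] PiE_mem[OF X(1) that] by (rule openE) blast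
  then have "\<forall>f\<in>A. \<exists>r>0. ball (\<psi> f) r \<subseteq> X f" by blast
  from bchoice[OF this] obtain r where r: "\<And>f. f \<in> A \<Longrightarrow> 0 < r f \<and> ball (\<psi> f) (r f) \<subseteq> X f"
    by blast
  show "\<exists>y. y \<in> (\<lambda>x. \<lambda>f\<in>A. f x) ` S \<and> y \<in> W"
  proof (rule ccontr)
    assume none: "\<not> ?thesis"
    have far: "\<exists>f\<in>I. r f \<le> dist (\<psi> f) (f x)" if "x \<in> S" for x
    proof (rule ccontr)
      assume "\<not> ?thesis"
      then have "(\<lambda>f\<in>A. f x) \<in> (\<Pi>\<^sub>E f\<in>A. X f)"
        using r by (force simp: I_def)
      then show False using none X(4) that by blast
    qed
    define u where "u = (\<lambda>f. \<lambda>x\<in>S. (f x - \<psi> f) * cnj (f x - \<psi> f))"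
    have u: "u f \<in> A \<and> \<psi> (u f) = 0" if f: "f \<in> I" for f
    proof -
      have fA: "f \<in> A" using f by (simp add: I_def)
      note comp = bounded_unif_cont_comp[OF U, folded A_def]
      have c: "(\<lambda>x\<in>S. - \<psi> f) \<in> A" unfolding A_def by (rule bounded_unif_cont_const[OF U])
      define v where "v = (\<lambda>x\<in>S. f x + (\<lambda>x\<in>S. - \<psi> f) x)"
      define w where "w = (\<lambda>x\<in>S. cnj (f x + (\<lambda>x\<in>S. - \<psi> f) x))"
      have vA: "v \<in> A" unfolding v_def
        by (rule comp[OF fA c]) (auto simp: case_prod_unfold intro!: continuous_intros)
      have wA: "w \<in> A" unfolding w_def
        by (rule comp[OF fA c, of "\<lambda>y z. cnj (y + z)"]) (auto simp: case_prod_unfold intro!: continuous_intros)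
      have "\<psi> v = 0"
        unfolding v_def charactersD(2)[OF \<psi>' fA c] character_const[OF U \<psi>] by simp
      moreover have "u f = (\<lambda>x\<in>S. v x * w x)"
        by (auto simp: u_def v_def w_def fun_eq_iff)
      moreover have "(\<lambda>x\<in>S. v x * w x) \<in> A"
        by (rule comp[OF vA wA]) (auto simp: case_prod_unfold intro!: continuous_intros)
      ultimately show ?thesis using charactersD(4)[OF \<psi>' vA wA] by (metis mult_zero_left)
    qed
    define h where "h = (\<lambda>x\<in>S. \<Sum>f\<in>I. u f x)"
    have h: "h \<in> A" "\<psi> h = 0"
      using character_sum_eq_0[OF U \<psi> \<open>finite I\<close>, of u] u unfolding h_def A_def by blast+
    have "I \<noteq> {}" using far \<open>S \<noteq> {}\<close> by blast
    define \<epsilon> where "\<epsilon> = Min (r ` I)"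
    have "0 < \<epsilon>" using r \<open>finite I\<close> \<open>I \<noteq> {}\<close> by (auto simp: \<epsilon>_def I_def)
    have h_ge: "\<epsilon>\<^sup>2 \<le> Re (h x)" if x: "x \<in> S" for x
    proof -
      obtain f where f: "f \<in> I" "r f \<le> dist (\<psi> f) (f x)" using far[OF x] by blast
      have ru: "Re (u g x) = (dist (\<psi> g) (g x))\<^sup>2" for g
      proof -
        have "(dist (\<psi> g) (g x))\<^sup>2 = (Re (\<psi> g) - Re (g x))\<^sup>2 + (Im (\<psi> g) - Im (g x))\<^sup>2"
          by (simp add: dist_norm cmod_power2)
        then show ?thesis using x by (simp add: u_def power2_eq_square algebra_simps)
      qed
      have "\<epsilon> \<le> dist (\<psi> f) (f x)"
        using f \<open>finite I\<close> unfolding \<epsilon>_def by (meson Min_le finite_imageI imageI order_trans)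
      then have "\<epsilon>\<^sup>2 \<le> (dist (\<psi> f) (f x))\<^sup>2" using \<open>0 < \<epsilon>\<close> by (intro power_mono) auto
      also have "\<dots> \<le> (\<Sum>g\<in>I. (dist (\<psi> g) (g x))\<^sup>2)"
        by (rule member_le_sum[OF f(1)]) (auto simp: \<open>finite I\<close>)
      also have "\<dots> = Re (h x)" using x by (simp add: h_def ru)
      finally show ?thesis .
    qed
    \<comment> \<open>A compact set containing the range of \<open>h\<close> on which inversion is continuous.\<close>
    define K where "K = closure (h ` S) \<inter> {z. \<epsilon>\<^sup>2 \<le> Re z}"
    have "compact K"
      using h(1) unfolding K_def A_def mem_bounded_unif_cont_iff
      by (intro compact_Int_closed closed_halfspace_Re_ge) auto
    have "continuous_on (K \<times> K) (\<lambda>p. inverse (fst p))"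
      using \<open>0 < \<epsilon>\<close> by (intro continuous_intros) (auto simp: K_def)
    from bounded_unif_cont_comp2[OF U h(1)[unfolded A_def] h(1)[unfolded A_def]
        compact_Times[OF \<open>compact K\<close> \<open>compact K\<close>] _ this]
    have inv: "(\<lambda>x\<in>S. inverse (h x)) \<in> A"
      unfolding A_def fst_conv by this (use h_ge subsetD[OF closure_subset imageI] in \<open>auto simp: K_def\<close>)
    have "(\<lambda>x\<in>S. h x * (\<lambda>x\<in>S. inverse (h x)) x) = (\<lambda>x\<in>S. 1)"
    proof
      fix x
      have "h x \<noteq> 0" if "x \<in> S" using h_ge[OF that] \<open>0 < \<epsilon>\<close> by auto
      then show "(\<lambda>x\<in>S. h x * (\<lambda>x\<in>S. inverse (h x)) x) x = (\<lambda>x\<in>S. 1) x" by auto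
    qed
    then show False
      using charactersD(4)[OF \<psi>' h(1) inv] h(2) character_const[OF U \<psi>, of 1] by (metis mult_zero_left zero_neq_one)
  qed
qed

text \<open>A recognition criterion: a compact Hausdorff space \<open>L\<close> with a dense image of \<open>S\<close> is the Samuel
compactification as soon as bounded uniformly continuous functions have small oscillation near every
point of \<open>L\<close>, and the points of \<open>L\<close> are separated by continuous functions that are uniformly continuous on
\<open>S\<close>. The homeomorphism sends a point of \<open>L\<close> to the character evaluating continuous extensions there.\<close>

theorem homeomorphic_map_samuel_compactification:
  fixes L :: "'l topology" and i :: "'s \<Rightarrow> 'l"
  assumes U: "U \<le> principal (S \<times> S)" and "S \<noteq> {}"
    and L: "compact_space L" "Hausdorff_space L" and i: "i ` S \<subseteq> topspace L"
    and dense: "L closure_of (i ` S) = topspace L"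
    and osc: "\<And>f C \<epsilon>. f \<in> bounded_unif_cont S U \<Longrightarrow> C \<in> topspace L \<Longrightarrow> 0 < \<epsilon> \<Longrightarrow>
      \<exists>N. openin L N \<and> C \<in> N \<and> (\<forall>s\<in>S. \<forall>t\<in>S. i s \<in> N \<longrightarrow> i t \<in> N \<longrightarrow> dist (f s) (f t) < \<epsilon>)"
    and sep: "\<And>C D. C \<in> topspace L \<Longrightarrow> D \<in> topspace L \<Longrightarrow> C \<noteq> D \<Longrightarrow>
      \<exists>\<Phi>. continuous_map L euclideanreal \<Phi> \<and> \<Phi> C \<noteq> \<Phi> D \<and>
        (\<forall>\<epsilon>>0. eventually (\<lambda>(s, t). dist (\<Phi> (i s)) (\<Phi> (i t)) < \<epsilon>) U)"
  obtains h where "homeomorphic_map L (fst (samuel_compactification S U)) h"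
    "\<And>s. s \<in> S \<Longrightarrow> h (i s) = snd (samuel_compactification S U) s"
proof -
  define A where "A = bounded_unif_cont S U"
  define P where "P = product_topology (\<lambda>_::'s \<Rightarrow> complex. euclidean :: complex topology) A"
  define M where "M = fst (samuel_compactification S U)"
  define e where "e = (\<lambda>x::'s. \<lambda>f\<in>A. f x)"
  have M: "M = subtopology P (characters S A)" and e: "snd (samuel_compactification S U) = e"
    by (simp_all add: M_def samuel_compactification_def Let_def A_def P_def e_def)
  have "\<exists>F. continuous_map L euclidean F \<and> (\<forall>s\<in>S. F (i s) = f s)" if "f \<in> A" for f
    using continuous_map_extension_from_dense[OF dense osc[OF that[unfolded A_def]]] i
    by (metis image_subset_iff)
  then obtain F where F: "\<And>f. f \<in> A \<Longrightarrow> continuous_map L euclidean (F f)"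
      "\<And>f s. f \<in> A \<Longrightarrow> s \<in> S \<Longrightarrow> F f (i s) = f s" by metis
  \<comment> \<open>By density an extension is determined by its values on \<open>S\<close>; all identities between extensions follow from this.\<close>
  have uniq: "F f C = G C" if "f \<in> A" "continuous_map L euclidean G" "\<And>s. s \<in> S \<Longrightarrow> G (i s) = f s"
      "C \<in> topspace L" for f G C
    by (rule forall_in_closure_of_eq[OF _ Hausdorff_space_euclidean F(1)[OF that(1)] that(2), of _ "i ` S"])
      (use that F(2) dense in auto)
  define h where "h = (\<lambda>C. \<lambda>f\<in>A. F f C)"
  have he: "h (i s) = e s" if "s \<in> S" for s using F(2) that by (auto simp: h_def e_def)
  note comp = bounded_unif_cont_comp[OF U, folded A_def]
  have char: "h C \<in> characters S A" if C: "C \<in> topspace L" for C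
  proof -
    have const: "(\<lambda>x\<in>S. c) \<in> A" for c unfolding A_def by (rule bounded_unif_cont_const[OF U])
    have hcomp: "(\<lambda>x\<in>S. \<phi> (f x) (g x)) \<in> A" "h C (\<lambda>x\<in>S. \<phi> (f x) (g x)) = \<phi> (h C f) (h C g)"
      if "f \<in> A" "g \<in> A" and \<phi>: "continuous_on UNIV (\<lambda>(y, z). \<phi> y z)" for f g \<phi>
    proof -
      show A: "(\<lambda>x\<in>S. \<phi> (f x) (g x)) \<in> A" by (rule comp[OF that])
      have "continuous_map L euclidean (\<lambda>C. (F f C, F g C))"
        unfolding prod_topology_euclidean[symmetric]
        by (intro continuous_map_pairedI F(1) that(1,2))
      then have "continuous_map L euclidean ((\<lambda>(y, z). \<phi> y z) \<circ> (\<lambda>C. (F f C, F g C)))"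
        by (rule continuous_map_compose) (use \<phi> in simp)
      from uniq[OF A this] show "h C (\<lambda>x\<in>S. \<phi> (f x) (g x)) = \<phi> (h C f) (h C g)"
        using C A that F(2) by (simp add: h_def)
    qed
    have "\<forall>f\<in>A. \<forall>g\<in>A. h C (\<lambda>x\<in>S. f x + g x) = h C f + h C g"
      by (intro ballI hcomp(2)) (auto simp: case_prod_unfold intro!: continuous_intros)
    moreover have "\<forall>f\<in>A. \<forall>g\<in>A. h C (\<lambda>x\<in>S. f x * g x) = h C f * h C g"
      by (intro ballI hcomp(2)) (auto simp: case_prod_unfold intro!: continuous_intros)
    moreover have "\<forall>f\<in>A. \<forall>z. h C (\<lambda>x\<in>S. z * f x) = z * h C f"
      by (intro ballI allI hcomp(2)[of _ _ "\<lambda>y x. _ * y"])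
        (auto simp: case_prod_unfold intro!: continuous_intros)
    moreover have "h C (\<lambda>x\<in>S. 1) = 1"
      using uniq[OF const, of "\<lambda>_. 1"] const C by (simp add: h_def)
    ultimately show ?thesis
      using const[of 1] unfolding characters_def by (auto simp: h_def intro!: bexI[of _ "\<lambda>x\<in>S. 1"])
  qed
  have P: "Hausdorff_space P" unfolding P_def by (simp add: Hausdorff_space_product_topology)
  have hP: "continuous_map L P h"
    unfolding P_def continuous_map_componentwise using F(1) by (auto simp: h_def)
  have hM: "continuous_map L M h"
    unfolding M using hP char by (auto simp: continuous_map_in_subtopology)
  have "closedin P (h ` topspace L)"
    using compactin_imp_closedin[OF P] image_compactin[OF _ hP] L(1) by (auto simp: compact_space_def)
  moreover have "e ` S \<subseteq> h ` topspace L" using he i by force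
  ultimately have "P closure_of (e ` S) \<subseteq> h ` topspace L" by (simp add: closure_of_minimal)
  moreover have "characters S A \<subseteq> P closure_of (e ` S)"
    using character_in_closure_of_evaluations[OF U \<open>S \<noteq> {}\<close>] by (auto simp: A_def P_def e_def)
  moreover have "topspace M \<subseteq> characters S A" by (simp add: M)
  moreover have "h ` topspace L \<subseteq> topspace M" using hM by (simp add: continuous_map_image_subset_topspace)
  ultimately have surj: "h ` topspace L = topspace M" by blast
  \<comment> \<open>A separating function \<open>\<Phi>\<close> restricts to an element of the algebra, whose extension to \<open>L\<close> is \<open>\<Phi>\<close> itself.\<close>
  have inj: "inj_on h (topspace L)"
  proof (rule inj_onI, rule ccontr)
    fix C D assume CD: "C \<in> topspace L" "D \<in> topspace L" "h C = h D" "C \<noteq> D"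
    obtain \<Phi> where \<Phi>: "continuous_map L euclideanreal \<Phi>" "\<Phi> C \<noteq> \<Phi> D"
        "\<And>\<epsilon>. 0 < \<epsilon> \<Longrightarrow> eventually (\<lambda>(s, t). dist (\<Phi> (i s)) (\<Phi> (i t)) < \<epsilon>) U"
      using sep[OF CD(1,2,4)] by blast
    define f where "f = (\<lambda>s\<in>S. complex_of_real (\<Phi> (i s)))"
    have "bounded (\<Phi> ` topspace L)"
      using image_compactin[OF _ \<Phi>(1)] L(1) by (auto simp: compact_space_def intro: compact_imp_bounded)
    then have "bounded (complex_of_real ` \<Phi> ` topspace L)"
      by (rule bounded_linear_image) (rule bounded_linear_of_real)
    then have "bounded (f ` S)"
      by (rule bounded_subset) (use i in \<open>auto simp: f_def\<close>)
    moreover have "eventually (\<lambda>(s, t). dist (f s) (f t) < \<epsilon>) U" if "0 < \<epsilon>" for \<epsilon>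
    proof -
      have "eventually (\<lambda>p. p \<in> S \<times> S) U" using U le_principal by blast
      with \<Phi>(3)[OF that] show ?thesis
        by eventually_elim (auto simp: f_def dist_of_real)
    qed
    ultimately have f: "f \<in> A" by (simp add: A_def mem_bounded_unif_cont_iff f_def)
    have "continuous_map L euclidean (complex_of_real \<circ> \<Phi>)"
      by (rule continuous_map_compose[OF \<Phi>(1)]) (auto intro!: continuous_intros)
    then have "F f E = complex_of_real (\<Phi> E)" if "E \<in> topspace L" for E
      using uniq[OF f _ _ that] by (simp add: f_def)
    then show False using CD \<Phi>(2) f by (auto simp: h_def fun_eq_iff split: if_splits)
  qed
  have "Hausdorff_space M" unfolding M using P by (rule Hausdorff_space_subtopology)
  then have "homeomorphic_map L M h"
    using continuous_imp_homeomorphic_map[OF hM L(1) _ surj inj] by blast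
  then show thesis using that he unfolding M_def e by blast
qed

section \<open>The Vietoris hyperspace of a compact space\<close>

text \<open>Alexander's subbase theorem for topologies given by a generating family.\<close>

lemma compact_space_topology_generated_by:
  assumes fin: "\<And>\<C>. \<C> \<subseteq> \<B> \<Longrightarrow> \<Union>\<C> = \<Union>\<B> \<Longrightarrow> \<exists>\<F>. finite \<F> \<and> \<F> \<subseteq> \<C> \<and> \<Union>\<F> = \<Union>\<B>"
  shows "compact_space (topology_generated_by \<B>)"
proof (rule Alexander_subbase[where \<B> = \<B>])
  let ?X = "topology (arbitrary union_of (finite intersection_of (\<lambda>x. x \<in> \<B>) relative_to \<Union>\<B>))"
  have ist: "istopology (arbitrary union_of (finite intersection_of (\<lambda>x. x \<in> \<B>) relative_to \<Union>\<B>))"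
    by (rule istopology_subbase)
  have "generate_topology_on \<B> W" if "openin ?X W" for W
  proof -
    have "generate_topology_on \<B> V" if V: "(finite intersection_of (\<lambda>x. x \<in> \<B>) relative_to \<Union>\<B>) V" for V
    proof -
      obtain \<F> where \<F>: "finite \<F>" "\<F> \<subseteq> \<B>" "V = \<Union>\<B> \<inter> \<Inter>\<F>"
        using V unfolding relative_to_def intersection_of_def by blast
      have top: "generate_topology_on \<B> (\<Union>\<B>)"
        by (intro generate_topology_on.UN generate_topology_on.Basis)
      have "generate_topology_on \<B> (\<Inter>(insert (\<Union>\<B>) \<F>))"
        by (rule generate_topology_on_Inter) (use \<F> top in \<open>auto intro: generate_topology_on.Basis\<close>)
      then show ?thesis using \<F> by simp
    qed
    moreover have "(arbitrary union_of (finite intersection_of (\<lambda>x. x \<in> \<B>) relative_to \<Union>\<B>)) W"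
      using that unfolding topology_inverse'[OF ist] .
    then obtain \<V> where "\<V> \<subseteq> Collect (finite intersection_of (\<lambda>x. x \<in> \<B>) relative_to \<Union>\<B>)" "\<Union>\<V> = W"
      unfolding union_of_def by blast
    ultimately show ?thesis
      by (metis generate_topology_on.UN mem_Collect_eq subsetD)
  qed
  moreover have "openin ?X W" if "generate_topology_on \<B> W" for W
  proof (rule generate_topology_on_coarsest[OF _ _ that])
    show "openin ?X V" if "V \<in> \<B>" for V
      by (rule openin_subbase[THEN iffD2])
        (use that in \<open>auto simp: arbitrary_def union_of_inc relative_to_inc intersection_of_inc intro!: union_of_inc relative_to_subset_inc\<close>)
  qed (rule istopology_openin)
  ultimately show "?X = topology_generated_by \<B>"
    unfolding topology_eq openin_topology_generated_by_iff by blast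
qed (use fin in simp)

lemma topspace_vietoris [simp]: "topspace (vietoris_topology Z) = nonempty_closed_sets Z"
proof -
  have "{C \<in> nonempty_closed_sets Z. C \<subseteq> topspace Z} = nonempty_closed_sets Z"
    by (auto simp: nonempty_closed_sets_def dest: closedin_subset)
  then have "nonempty_closed_sets Z \<in> {{C \<in> nonempty_closed_sets Z. C \<subseteq> U} | U. openin Z U}"
    by (intro CollectI exI[of _ "topspace Z"]) simp
  then show ?thesis
    unfolding vietoris_topology_def topology_generated_by_topspace by auto
qed

lemma openin_vietoris_subset: "openin Z U \<Longrightarrow> openin (vietoris_topology Z) {C \<in> nonempty_closed_sets Z. C \<subseteq> U}"
  and openin_vietoris_hit: "openin Z U \<Longrightarrow> openin (vietoris_topology Z) {C \<in> nonempty_closed_sets Z. C \<inter> U \<noteq> {}}"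
  unfolding vietoris_topology_def by (intro topology_generated_by_Basis; blast)+

text \<open>Given a cover by subbasic sets, let \<open>D\<close> be the closed set missed by all \<open>V\<close> whose hit sets belong to the
cover. Unless it is empty, \<open>D\<close> is a point of the hyperspace, and as no hit set of the cover contains it, it lies in some
\<open>U\<close> whose subset family belongs to the cover. The complement of \<open>U\<close> is compact and covered by finitely many \<open>V\<close>; a
closed set that is not inside \<open>U\<close> hits one of them.\<close>

lemma compact_space_vietoris:
  assumes Z: "compact_space Z"
  shows "compact_space (vietoris_topology Z)"
  unfolding vietoris_topology_def
proof (rule compact_space_topology_generated_by)
  let ?sub = "\<lambda>U. {C \<in> nonempty_closed_sets Z. C \<subseteq> U}" and ?hit = "\<lambda>U. {C \<in> nonempty_closed_sets Z. C \<inter> U \<noteq> {}}"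
  let ?\<B> = "{?sub U | U. openin Z U} \<union> {?hit U | U. openin Z U}"
  have top: "\<Union>?\<B> = nonempty_closed_sets Z"
    using topspace_vietoris[of Z] unfolding vietoris_topology_def topology_generated_by_topspace .
  fix \<C> assume \<C>: "\<C> \<subseteq> ?\<B>" "\<Union>\<C> = \<Union>?\<B>"
  define \<V> where "\<V> = {V. openin Z V \<and> ?hit V \<in> \<C>}"
  have op: "openin Z (\<Union>\<V>)" by (auto simp: \<V>_def)
  define D where "D = topspace Z - \<Union>\<V>"
  have "closedin Z D" using op by (auto simp: D_def)
  \<comment> \<open>Either the hit sets cover, or the set \<open>D\<close> missed by all of them lies in a member \<open>?sub U\<close>.\<close>
  have "\<exists>U \<C>'. openin Z U \<and> finite \<C>' \<and> \<C>' \<subseteq> \<C> \<and> ?sub U \<subseteq> \<Union>\<C>' \<and> D \<subseteq> U"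
  proof (cases "D = {}")
    case True
    then show ?thesis by (intro exI[of _ "{}"]) (auto simp: nonempty_closed_sets_def)
  next
    case False
    then have D: "D \<in> nonempty_closed_sets Z"
      using \<open>closedin Z D\<close> by (simp add: nonempty_closed_sets_def)
    then obtain B where B: "B \<in> \<C>" "D \<in> B" using \<C>(2) unfolding top by blast
    have "B \<noteq> ?hit V" if "openin Z V" for V
    proof
      assume "B = ?hit V"
      then have "V \<in> \<V>" "D \<inter> V \<noteq> {}" using that B unfolding \<V>_def by blast+
      then show False unfolding D_def by blast
    qed
    moreover have "B \<in> ?\<B>" using \<C>(1) B(1) by (rule subsetD)
    ultimately obtain U where "openin Z U" "B = ?sub U" by blast
    then show ?thesis using B by (intro exI[of _ U] exI[of _ "{B}"]) auto
  qed
  then obtain U \<C>' where U: "openin Z U" "finite \<C>'" "\<C>' \<subseteq> \<C>" "?sub U \<subseteq> \<Union>\<C>'" "D \<subseteq> U" by blast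
  have "compactin Z (topspace Z - U)"
    using Z U(1) by (intro closedin_compact_space) auto
  moreover have "openin Z V" if "V \<in> \<V>" for V using that unfolding \<V>_def by blast
  moreover have "topspace Z - U \<subseteq> \<Union>\<V>" using U(5) unfolding D_def by blast
  ultimately have "\<exists>\<F>. finite \<F> \<and> \<F> \<subseteq> \<V> \<and> topspace Z - U \<subseteq> \<Union>\<F>" by (rule compactinD)
  then obtain \<V>' where \<V>': "finite \<V>'" "\<V>' \<subseteq> \<V>" "topspace Z - U \<subseteq> \<Union>\<V>'" by blast
  have "C \<in> \<Union>(\<C>' \<union> ?hit ` \<V>')" if C: "C \<in> nonempty_closed_sets Z" for C
  proof (cases "C \<subseteq> U")
    case True
    then show ?thesis using U(4) C by blast
  next
    case False
    then obtain z where "z \<in> C" "z \<in> topspace Z - U"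
      using C closedin_subset unfolding nonempty_closed_sets_def by blast
    then obtain V where "V \<in> \<V>'" "z \<in> C \<inter> V" using \<V>'(3) by blast
    then show ?thesis using C by blast
  qed
  moreover have "\<C>' \<union> ?hit ` \<V>' \<subseteq> \<C>" using U(3) \<V>'(2) unfolding \<V>_def by blast
  ultimately have "\<Union>(\<C>' \<union> ?hit ` \<V>') = \<Union>?\<B>" unfolding top using \<C>(2) top by blast
  then show "\<exists>\<F>. finite \<F> \<and> \<F> \<subseteq> \<C> \<and> \<Union>\<F> = \<Union>?\<B>"
    using U(2) \<V>'(1) \<open>\<C>' \<union> ?hit ` \<V>' \<subseteq> \<C>\<close> by (intro exI[of _ "\<C>' \<union> ?hit ` \<V>'"]) simp
qed

lemma Hausdorff_space_vietoris:
  assumes "compact_space Z" "Hausdorff_space Z"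
  shows "Hausdorff_space (vietoris_topology Z)"
proof -
  have sep: "\<exists>U V. openin (vietoris_topology Z) U \<and> openin (vietoris_topology Z) V \<and> C \<in> U \<and> D \<in> V \<and> disjnt U V"
    if C: "C \<in> nonempty_closed_sets Z" and D: "D \<in> nonempty_closed_sets Z" and x: "x \<in> C" "x \<notin> D" for C D x
  proof -
    have "compactin Z {x}" "compactin Z D"
      using C D x assms(1) by (auto simp: nonempty_closed_sets_def closedin_compact_space dest: closedin_subset)
    then obtain U V where UV: "openin Z U" "openin Z V" "x \<in> U" "D \<subseteq> V" "disjnt U V"
      using assms(2) x(2) unfolding Hausdorff_space_compact_sets
      by (metis disjnt_insert1 disjnt_empty1 insert_subset)
    have "disjnt {C \<in> nonempty_closed_sets Z. C \<inter> U \<noteq> {}} {C \<in> nonempty_closed_sets Z. C \<subseteq> V}"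
      using UV(5) by (auto simp: disjnt_def)
    then show ?thesis
      using openin_vietoris_hit[OF UV(1)] openin_vietoris_subset[OF UV(2)] C D x UV by blast
  qed
  show ?thesis
    unfolding Hausdorff_space_def topspace_vietoris
  proof (intro allI impI)
    fix C D assume CD: "C \<in> nonempty_closed_sets Z \<and> D \<in> nonempty_closed_sets Z \<and> C \<noteq> D"
    then consider x where "x \<in> C" "x \<notin> D" | x where "x \<in> D" "x \<notin> C" by blast
    then show "\<exists>U V. openin (vietoris_topology Z) U \<and> openin (vietoris_topology Z) V \<and> C \<in> U \<and> D \<in> V \<and> disjnt U V"
      by cases (use CD sep disjnt_sym in meson)+
  qed
qed

lemma closedin_vietoris_hit:
  assumes "openin Z U" "closedin Z U"
  shows "closedin (vietoris_topology Z) {C \<in> nonempty_closed_sets Z. C \<inter> U \<noteq> {}}"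
proof -
  have "nonempty_closed_sets Z - {C \<in> nonempty_closed_sets Z. C \<inter> U \<noteq> {}} =
      {C \<in> nonempty_closed_sets Z. C \<subseteq> topspace Z - U}"
    by (auto simp: nonempty_closed_sets_def dest: closedin_subset)
  then show ?thesis
    unfolding closedin_def using openin_vietoris_subset[of Z "topspace Z - U"] assms by auto
qed

text \<open>Preimages of hit sets are open by joint continuity at one point of \<open>C\<close>; preimages of subset families are
open by the tube lemma, applied to the compact set \<open>C\<close>.\<close>

lemma continuous_map_vietoris_image:
  assumes Z: "compact_space Z" and Y: "Hausdorff_space Y"
    and \<alpha>: "continuous_map (prod_topology T Z) Y (\<lambda>(t, z). \<alpha> t z)"
  shows "continuous_map (prod_topology T (vietoris_topology Z)) (vietoris_topology Y) (\<lambda>(t, C). \<alpha> t ` C)"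
proof -
  let ?P = "prod_topology T (vietoris_topology Z)"
  have compact: "compactin Z C" if "C \<in> nonempty_closed_sets Z" for C
    using that Z closedin_compact_space by (auto simp: nonempty_closed_sets_def)
  have img: "\<alpha> t ` C \<in> nonempty_closed_sets Y" if t: "t \<in> topspace T" and C: "C \<in> nonempty_closed_sets Z" for t C
  proof -
    have "continuous_map Z (prod_topology T Z) (\<lambda>z. (t, z))"
      using t by (simp add: continuous_map_pairedI)
    from continuous_map_compose[OF this \<alpha>] have "continuous_map Z Y (\<alpha> t)" by (simp add: o_def)
    then have "closedin Y (\<alpha> t ` C)"
      using compactin_imp_closedin[OF Y] image_compactin compact[OF C] by blast
    then show ?thesis using C by (simp add: nonempty_closed_sets_def)
  qed
  have W: "openin (prod_topology T Z) {p \<in> topspace T \<times> topspace Z. (\<lambda>(t, z). \<alpha> t z) p \<in> U}" if "openin Y U" for U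
    using openin_continuous_map_preimage[OF \<alpha> that] by simp
  have sub: "openin ?P {p \<in> topspace ?P. (\<lambda>(t, C). \<alpha> t ` C) p \<subseteq> U}" if U: "openin Y U" for U
  proof (subst openin_subopen, intro ballI)
    fix p assume p: "p \<in> {p \<in> topspace ?P. (\<lambda>(t, C). \<alpha> t ` C) p \<subseteq> U}"
    obtain t C where tC: "p = (t, C)" "t \<in> topspace T" "C \<in> nonempty_closed_sets Z" "\<alpha> t ` C \<subseteq> U"
      using p by auto
    have "{t} \<times> C \<subseteq> {p \<in> topspace T \<times> topspace Z. (\<lambda>(t, z). \<alpha> t z) p \<in> U}"
      using tC compactin_subset_topspace[OF compact[OF tC(3)]] by auto
    from tube_lemma_right[OF W[OF U] compact[OF tC(3)] tC(2) this]
    obtain N V where NV: "openin T N" "openin Z V" "t \<in> N" "C \<subseteq> V"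
      "N \<times> V \<subseteq> {p \<in> topspace T \<times> topspace Z. (\<lambda>(t, z). \<alpha> t z) p \<in> U}" by blast
    have "N \<times> {C \<in> nonempty_closed_sets Z. C \<subseteq> V} \<subseteq> {p \<in> topspace ?P. (\<lambda>(t, C). \<alpha> t ` C) p \<subseteq> U}"
      using NV(5) openin_subset[OF NV(1)] by fastforce
    moreover have "openin ?P (N \<times> {C \<in> nonempty_closed_sets Z. C \<subseteq> V})"
      using NV openin_vietoris_subset by (auto simp: openin_prod_Times_iff)
    ultimately show "\<exists>Q. openin ?P Q \<and> p \<in> Q \<and> Q \<subseteq> {p \<in> topspace ?P. (\<lambda>(t, C). \<alpha> t ` C) p \<subseteq> U}"
      using tC NV by blast
  qed
  have hit: "openin ?P {p \<in> topspace ?P. (\<lambda>(t, C). \<alpha> t ` C) p \<inter> U \<noteq> {}}" if U: "openin Y U" for U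
  proof (subst openin_subopen, intro ballI)
    fix p assume p: "p \<in> {p \<in> topspace ?P. (\<lambda>(t, C). \<alpha> t ` C) p \<inter> U \<noteq> {}}"
    then obtain t C z where tC: "p = (t, C)" "t \<in> topspace T" "C \<in> nonempty_closed_sets Z" "z \<in> C" "\<alpha> t z \<in> U"
      unfolding topspace_prod_topology topspace_vietoris by blast
    have "(t, z) \<in> {p \<in> topspace T \<times> topspace Z. (\<lambda>(t, z). \<alpha> t z) p \<in> U}"
      using tC compactin_subset_topspace[OF compact[OF tC(3)]] by auto
    from W[OF U, unfolded openin_prod_topology_alt, rule_format, OF this]
    obtain N V where NV: "openin T N" "openin Z V" "t \<in> N" "z \<in> V"
      "N \<times> V \<subseteq> {p \<in> topspace T \<times> topspace Z. (\<lambda>(t, z). \<alpha> t z) p \<in> U}" by blast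
    have "N \<times> {C \<in> nonempty_closed_sets Z. C \<inter> V \<noteq> {}} \<subseteq> {p \<in> topspace ?P. (\<lambda>(t, C). \<alpha> t ` C) p \<inter> U \<noteq> {}}"
      using NV(5) openin_subset[OF NV(1)] by fastforce
    moreover have "openin ?P (N \<times> {C \<in> nonempty_closed_sets Z. C \<inter> V \<noteq> {}})"
      using NV openin_vietoris_hit by (auto simp: openin_prod_Times_iff)
    ultimately show "\<exists>Q. openin ?P Q \<and> p \<in> Q \<and> Q \<subseteq> {p \<in> topspace ?P. (\<lambda>(t, C). \<alpha> t ` C) p \<inter> U \<noteq> {}}"
      using tC NV by blast
  qed
  have pre: "(\<lambda>(t, C). \<alpha> t ` C) -` {D \<in> nonempty_closed_sets Y. Q D} \<inter> topspace ?P =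
      {p \<in> topspace ?P. Q ((\<lambda>(t, C). \<alpha> t ` C) p)}" for Q
    using img by auto
  show ?thesis
    unfolding vietoris_topology_def[of Y]
  proof (rule continuous_on_generated_topo)
    fix B assume "B \<in> {{C \<in> nonempty_closed_sets Y. C \<subseteq> U} |U. openin Y U} \<union>
      {{C \<in> nonempty_closed_sets Y. C \<inter> U \<noteq> {}} |U. openin Y U}"
    then show "openin ?P ((\<lambda>(t, C). \<alpha> t ` C) -` B \<inter> topspace ?P)"
      using sub hit by (auto simp only: pre mem_Collect_eq Un_iff)
  next
    show "(\<lambda>(t, C). \<alpha> t ` C) ` topspace ?P \<subseteq> \<Union> ({{C \<in> nonempty_closed_sets Y. C \<subseteq> U} |U. openin Y U} \<union>
      {{C \<in> nonempty_closed_sets Y. C \<inter> U \<noteq> {}} |U. openin Y U})"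
      using topspace_vietoris[of Y] img unfolding vietoris_topology_def topology_generated_by_topspace by auto
  qed
qed

section \<open>Cyclic orders and double cosets of stabilizers\<close>

lemma
  assumes "cyclic_order R"
  shows cyclic_order_rotate: "R a b c \<Longrightarrow> R b c a"
    and cyclic_order_asym: "R a b c \<Longrightarrow> \<not> R b a c"
    and cyclic_order_trans: "R a b c \<Longrightarrow> R a c d \<Longrightarrow> R a b d"
    and cyclic_order_total: "a \<noteq> b \<Longrightarrow> b \<noteq> c \<Longrightarrow> a \<noteq> c \<Longrightarrow> R a b c \<or> R a c b"
proof -
  note ax = assms[unfolded cyclic_order_def, THEN conjunct2]
  show "R a b c \<Longrightarrow> R b c a" using ax[THEN conjunct1] by blast
  show "R a b c \<Longrightarrow> \<not> R b a c" using ax[THEN conjunct2, THEN conjunct1] by blast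
  show "R a b c \<Longrightarrow> R a c d \<Longrightarrow> R a b d"
    using ax[THEN conjunct2, THEN conjunct2, THEN conjunct1] by blast
  show "a \<noteq> b \<Longrightarrow> b \<noteq> c \<Longrightarrow> a \<noteq> c \<Longrightarrow> R a b c \<or> R a c b"
    using ax[THEN conjunct2, THEN conjunct2, THEN conjunct2] by blast
qed

lemma cyclic_order_distinct:
  assumes "cyclic_order R" "R a b c"
  shows "a \<noteq> b" "b \<noteq> c" "a \<noteq> c"
  using cyclic_order_rotate[OF assms(1)] cyclic_order_asym[OF assms(1)] assms(2) by blast+

text \<open>Cutting the cyclic order at \<open>s\<close> leaves a linear order on the other points.\<close>

lemma sorted_wrt_cyclic_order_exists:
  assumes R: "cyclic_order R" and "finite T" "s \<notin> T"
  shows "\<exists>ys. set ys = T \<and> sorted_wrt (R s) ys"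
  using assms(2,3)
proof (induction T rule: finite_induct)
  case (insert a T)
  then obtain ys where ys: "set ys = T" "sorted_wrt (R s) ys" by auto
  let ?zs = "filter (\<lambda>b. R s b a) ys @ a # filter (R s a) ys"
  have "R s b a \<or> R s a b" if "b \<in> T" for b
    using cyclic_order_total[OF R, of s b a] insert that by auto
  then have "set ?zs = insert a T" using ys(1) by auto
  moreover have "sorted_wrt (R s) ?zs"
    using ys(2) cyclic_order_trans[OF R] by (auto simp: sorted_wrt_append sorted_wrt_filter)
  ultimately show ?case by blast
qed simp

lemma cycle_enumeration_exists:
  assumes R: "cyclic_order R" and "finite S" "S \<noteq> {}"
  shows "\<exists>xs. set xs = S \<and> distinct xs \<and> is_cycle R xs"
proof -
  obtain s where s: "s \<in> S" using assms(3) by blast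
  obtain ys where ys: "set ys = S - {s}" "sorted_wrt (R s) ys"
    using sorted_wrt_cyclic_order_exists[OF R, of "S - {s}" s] assms(2) by auto
  have "distinct ys"
    unfolding distinct_conv_nth
    using sorted_wrt_nth_less[OF ys(2)] cyclic_order_distinct(2)[OF R]
    by (metis nat_neq_iff)
  then have dist: "distinct (s # ys)" using ys(1) by simp
  have tri: "R ((s # ys) ! i) ((s # ys) ! j) ((s # ys) ! k)"
    if ijk: "i < j" "j < k" "k < length (s # ys)" for i j k
  proof -
    obtain j' k' where j: "j = Suc j'" and k: "k = Suc k'"
      using ijk by (metis less_nat_zero_code not0_implies_Suc)
    have jk: "R s (ys ! j') (ys ! k')"
      using sorted_wrt_nth_less[OF ys(2)] ijk j k by simp
    show ?thesis
    proof (cases i)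
      case 0
      then show ?thesis using jk j k by simp
    next
      case (Suc i')
      then have "R s (ys ! i') (ys ! j')"
        using sorted_wrt_nth_less[OF ys(2)] ijk j k by simp
      then have "R (ys ! i') (ys ! j') (ys ! k')"
        using jk cyclic_order_rotate[OF R] cyclic_order_trans[OF R] by blast
      then show ?thesis using Suc j k by simp
    qed
  qed
  have "is_cycle R (s # ys)"
  proof (cases "length ys \<le> 1")
    case True
    then consider "ys = []" | y where "ys = [y]" by (cases ys) auto
    then show ?thesis using dist by cases (auto simp: is_cycle_def)
  next
    case False
    then show ?thesis using tri by (simp add: is_cycle_def)
  qed
  then show ?thesis using dist ys(1) s by (intro exI[of _ "s # ys"]) auto
qed

text \<open>Ultrahomogeneity speaks of tuples that are cycles. Since every finite set can be listed as a cycle, it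
applies to finite partial isomorphisms without a chosen listing.\<close>

lemma ultrahomogeneous_extend:
  assumes R: "cyclic_order R" and uh: "ultrahomogeneous R" and S: "finite S" "S \<noteq> {}"
    and inj: "inj_on \<phi> S"
    and pres: "\<And>a b c. a \<in> S \<Longrightarrow> b \<in> S \<Longrightarrow> c \<in> S \<Longrightarrow> R a b c \<Longrightarrow> R (\<phi> a) (\<phi> b) (\<phi> c)"
  shows "\<exists>g\<in>carrier (aut_group R). \<forall>x\<in>S. g x = \<phi> x"
proof -
  obtain xs where xs: "set xs = S" "distinct xs" "is_cycle R xs"
    using cycle_enumeration_exists[OF R S] by blast
  have "is_cycle R (map \<phi> xs)"
    using xs(3) unfolding is_cycle_def length_map
  proof (elim disjE conjE)
    assume l: "length xs = 2" "xs ! 0 \<noteq> xs ! 1"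
    then have "map \<phi> xs ! 0 \<noteq> map \<phi> xs ! 1"
      using inj xs(1) by (simp add: inj_on_def) (metis nth_mem pos2 less_2_cases_iff)
    then show "length xs = 1 \<or> length xs = 2 \<and> map \<phi> xs ! 0 \<noteq> map \<phi> xs ! 1 \<or> 3 \<le> length xs \<and>
      (\<forall>i j k. i < j \<and> j < k \<and> k < length xs \<longrightarrow> R (map \<phi> xs ! i) (map \<phi> xs ! j) (map \<phi> xs ! k))"
      using l by simp
  next
    assume "3 \<le> length xs" "\<forall>i j k. i < j \<and> j < k \<and> k < length xs \<longrightarrow> R (xs ! i) (xs ! j) (xs ! k)"
    then show "length xs = 1 \<or> length xs = 2 \<and> map \<phi> xs ! 0 \<noteq> map \<phi> xs ! 1 \<or> 3 \<le> length xs \<and>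
      (\<forall>i j k. i < j \<and> j < k \<and> k < length xs \<longrightarrow> R (map \<phi> xs ! i) (map \<phi> xs ! j) (map \<phi> xs ! k))"
      using xs(1) by (intro disjI2) (auto intro!: pres)
  qed simp
  then obtain g where "g \<in> carrier (aut_group R)" "map g xs = map \<phi> xs"
    using uh xs(3) unfolding ultrahomogeneous_def by (metis length_map)
  then show ?thesis using xs(1) by (auto simp: map_eq_conv)
qed

lemma carrier_aut_group: "g \<in> carrier (aut_group R) \<longleftrightarrow> bij g \<and> (\<forall>a b c. R (g a) (g b) (g c) \<longleftrightarrow> R a b c)"
  and mult_aut_group [simp]: "g \<otimes>\<^bsub>aut_group R\<^esub> h = g \<circ> h"
  and one_aut_group [simp]: "\<one>\<^bsub>aut_group R\<^esub> = id"
  by (auto simp: aut_group_def)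

lemma aut_group_closed:
  assumes "g \<in> carrier (aut_group R)"
  shows "h \<in> carrier (aut_group R) \<Longrightarrow> g \<circ> h \<in> carrier (aut_group R)"
    and "inv g \<in> carrier (aut_group R)"
  using assms unfolding carrier_aut_group
  by (auto simp: bij_comp bij_imp_bij_inv) (metis bij_inv_eq_iff)+

lemma id_in_aut_group: "id \<in> carrier (aut_group R)"
  by (simp add: carrier_aut_group)

text \<open>The degenerate arc from \<open>a\<close> to \<open>a\<close> is the single point \<open>a\<close>. In this way points and open arcs form one family indexed by
pairs, and conditions of the form \<open>g x = y\<close> are among the conditions on arcs.\<close>

definition cyclic_arc :: "('a \<Rightarrow> 'a \<Rightarrow> 'a \<Rightarrow> bool) \<Rightarrow> 'a \<Rightarrow> 'a \<Rightarrow> 'a set" where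
  "cyclic_arc R a b = (if a = b then {a} else {x. R a x b})"

lemma cyclic_arc_image: "g \<in> carrier (aut_group R) \<Longrightarrow> g x \<in> cyclic_arc R (g a) (g b) \<longleftrightarrow> x \<in> cyclic_arc R a b"
  by (auto simp: cyclic_arc_def carrier_aut_group bij_def inj_eq)

definition pointwise_stabilizer :: "('a \<Rightarrow> 'a \<Rightarrow> 'a \<Rightarrow> bool) \<Rightarrow> 'a set \<Rightarrow> ('a \<Rightarrow> 'a) set" where
  "pointwise_stabilizer R F = {v \<in> carrier (aut_group R). \<forall>x\<in>F. v x = x}"

text \<open>The candidate for \<open>v\<close> on \<open>F \<union> g F\<close> fixes \<open>F\<close> and sends \<open>g x\<close> to \<open>h x\<close>. It preserves the cyclic order:
triples inside \<open>F\<close> or inside \<open>g F\<close> cause no problem; a triple with two points of \<open>F\<close> says in which arc of \<open>F\<close> a point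
\<open>g x\<close> lies; and a triple with one point \<open>y\<close> of \<open>F\<close> says, after applying \<open>g\<inverse>\<close>, in which arc of \<open>F\<close>
the point \<open>g\<inverse> y\<close> lies. The last two are given by the pattern. By ultrahomogeneity the candidate extends
to an automorphism \<open>v\<close>, and then \<open>w = g\<inverse> v\<inverse> h\<close> fixes \<open>F\<close>.\<close>

lemma arc_pattern_determines_double_coset:
  assumes R: "cyclic_order R" and uh: "ultrahomogeneous R" and F: "finite F"
    and g: "g \<in> carrier (aut_group R)" and h: "h \<in> carrier (aut_group R)"
    and pattern: "\<And>a b c d. a \<in> F \<Longrightarrow> b \<in> F \<Longrightarrow> c \<in> F \<Longrightarrow> d \<in> F \<Longrightarrow>
      (\<exists>x\<in>cyclic_arc R a b. g x \<in> cyclic_arc R c d) \<longleftrightarrow> (\<exists>x\<in>cyclic_arc R a b. h x \<in> cyclic_arc R c d)"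
  shows "\<exists>v\<in>pointwise_stabilizer R F. \<exists>w\<in>pointwise_stabilizer R F. h = v \<circ> g \<circ> w"
proof -
  have bij: "bij g" "bij h" and
    Rg: "\<And>a b c. R (g a) (g b) (g c) \<longleftrightarrow> R a b c" and Rh: "\<And>a b c. R (h a) (h b) (h c) \<longleftrightarrow> R a b c"
    using g h by (auto simp: carrier_aut_group)
  have gi: "g (inv g y) = y" "inv g (g y) = y" and hi: "h (inv h y) = y" "inv h (h y) = y" for y
    using bij by (simp_all add: bij_is_surj surj_f_inv_f bij_is_inj)
  \<comment> \<open>Degenerate first or second arcs in the pattern locate \<open>g x\<close> and \<open>inv g y\<close> for \<open>x, y \<in> F\<close>.\<close>
  have img: "g x \<in> cyclic_arc R c d \<longleftrightarrow> h x \<in> cyclic_arc R c d" if "x \<in> F" "c \<in> F" "d \<in> F" for x c d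
    using pattern[of x x c d] that by (simp add: cyclic_arc_def)
  have pre: "inv g y \<in> cyclic_arc R a b \<longleftrightarrow> inv h y \<in> cyclic_arc R a b" if "y \<in> F" "a \<in> F" "b \<in> F" for y a b
  proof -
    have "(\<exists>x\<in>cyclic_arc R a b. g x = y) \<longleftrightarrow> (\<exists>x\<in>cyclic_arc R a b. h x = y)"
      using pattern[of a b y y] that by (simp add: cyclic_arc_def)
    then show ?thesis using gi hi by metis
  qed
  have rot: "R b c a \<longleftrightarrow> R a b c" "R c a b \<longleftrightarrow> R a b c" for a b c
    using cyclic_order_rotate[OF R] by blast+
  define \<phi> where "\<phi> = (\<lambda>z. if z \<in> F then z else h (inv g z))"
  have \<phi>F: "\<phi> y = y" if "y \<in> F" for y using that by (simp add: \<phi>_def)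
  have \<phi>g: "\<phi> (g x) = h x" if "x \<in> F" for x
    using img[of x "g x" "g x"] that gi by (auto simp: \<phi>_def cyclic_arc_def)
  \<comment> \<open>Up to rotation \<open>R y1 y2 (g x)\<close> says that \<open>g x\<close> lies on the arc from \<open>y2\<close> to \<open>y1\<close>.\<close>
  have two: "R y1 y2 (h x)" if "R y1 y2 (g x)" "x \<in> F" "y1 \<in> F" "y2 \<in> F" for x y1 y2
    using img[of x y2 y1] that cyclic_order_distinct[OF R that(1)] rot by (auto simp: cyclic_arc_def)
  \<comment> \<open>Likewise \<open>R y (g x1) (g x2)\<close> puts \<open>inv g y\<close> on the arc from \<open>x2\<close> to \<open>x1\<close>.\<close>
  have one: "R y (h x1) (h x2)" if y: "R y (g x1) (g x2)" "y \<in> F" "x1 \<in> F" "x2 \<in> F" for y x1 x2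
  proof -
    have "R (inv g y) x1 x2" using y(1) Rg[of "inv g y" x1 x2] gi by simp
    then have "R (inv h y) x1 x2"
      using pre[of y x2 x1] y cyclic_order_distinct[OF R, of "inv g y" x1 x2] rot by (auto simp: cyclic_arc_def)
    then show ?thesis using Rh[of "inv h y" x1 x2] hi by simp
  qed
  have "inj_on \<phi> (F \<union> g ` F)"
  proof (rule inj_onI)
    have mixed: "y = g x" if "y \<in> F" "x \<in> F" "y = h x" for x y
      using img[of x y y] that by (auto simp: cyclic_arc_def)
    fix a b assume "a \<in> F \<union> g ` F" "b \<in> F \<union> g ` F" "\<phi> a = \<phi> b"
    then show "a = b"
      using \<phi>F \<phi>g mixed bij_is_inj[OF bij(2)] by (auto simp: inj_eq)
  qed
  moreover have "R (\<phi> a) (\<phi> b) (\<phi> c)"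
    if abc: "a \<in> F \<union> g ` F" "b \<in> F \<union> g ` F" "c \<in> F \<union> g ` F" "R a b c" for a b c
  proof -
    consider "a \<in> F" | x where "x \<in> F" "a = g x" using abc(1) by blast
    note ca = this
    consider "b \<in> F" | x where "x \<in> F" "b = g x" using abc(2) by blast
    note cb = this
    consider "c \<in> F" | x where "x \<in> F" "c = g x" using abc(3) by blast
    note cc = this
    show ?thesis
      by (rule ca; rule cb; rule cc) (use abc(4) two one rot \<phi>F \<phi>g Rg Rh in metis)+
  qed
  ultimately have ext: "\<exists>v\<in>carrier (aut_group R). \<forall>z\<in>F \<union> g ` F. v z = \<phi> z"
    if "F \<noteq> {}" using ultrahomogeneous_extend[OF R uh, of "F \<union> g ` F" \<phi>] F that by simp
  have "\<exists>v\<in>carrier (aut_group R). \<forall>z\<in>F \<union> g ` F. v z = \<phi> z"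
    using ext id_in_aut_group[of R] by (cases "F = {}") auto
  then obtain v where v: "v \<in> carrier (aut_group R)" "\<And>z. z \<in> F \<union> g ` F \<Longrightarrow> v z = \<phi> z" by blast
  have vF: "v \<in> pointwise_stabilizer R F" using v \<phi>F by (simp add: pointwise_stabilizer_def)
  have "bij v" using v(1) by (simp add: carrier_aut_group)
  then have vi: "v (inv v z) = z" "inv v (v z) = z" for z
    by (simp_all add: bij_is_surj surj_f_inv_f bij_is_inj)
  define w where "w = inv g \<circ> (inv v \<circ> h)"
  have "w x = x" if "x \<in> F" for x
  proof -
    have "v (g x) = h x" using v(2) \<phi>g that by simp
    then show ?thesis unfolding w_def using vi gi by (metis comp_apply)
  qed
  moreover have "w \<in> carrier (aut_group R)"
    unfolding w_def using g h v(1) by (intro aut_group_closed)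
  ultimately have "w \<in> pointwise_stabilizer R F" by (simp add: pointwise_stabilizer_def)
  moreover have "h = v \<circ> g \<circ> w"
    unfolding w_def using vi gi by (simp add: fun_eq_iff)
  ultimately show ?thesis using vF by blast
qed

section \<open>The permutation topology\<close>

lemma topspace_permutation_topology [simp]: "topspace (permutation_topology R) = carrier (aut_group R)"
  by (simp add: permutation_topology_def)

lemma openin_permutation_topology_point:
  "openin (permutation_topology R) {g \<in> carrier (aut_group R). g c \<in> A}"
proof -
  have "continuous_map (permutation_topology R) (discrete_topology UNIV) (\<lambda>g. g c)"
    unfolding permutation_topology_def
    by (intro continuous_map_from_subtopology continuous_map_product_coordinates) simp
  from openin_continuous_map_preimage[OF this, of A] show ?thesis by simp
qed

lemma openin_pointwise_stabilizer:
  assumes "finite F"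
  shows "openin (permutation_topology R) (pointwise_stabilizer R F)"
  using assms
proof (induction F)
  case empty
  then show ?case using openin_topspace[of "permutation_topology R"]
    by (simp add: pointwise_stabilizer_def)
next
  case (insert x F)
  have "pointwise_stabilizer R (insert x F) =
      pointwise_stabilizer R F \<inter> {g \<in> carrier (aut_group R). g x \<in> {x}}"
    by (auto simp: pointwise_stabilizer_def)
  then show ?case
    using openin_Int[OF insert.IH openin_permutation_topology_point[of R x "{x}"]] by simp
qed

lemma pointwise_stabilizer_in_nhd:
  assumes V: "openin (permutation_topology R) V" "id \<in> V"
  obtains F where "finite F" "pointwise_stabilizer R F \<subseteq> V"
proof -
  obtain W where W: "openin (product_topology (\<lambda>_. discrete_topology UNIV) UNIV) W"
      "V = W \<inter> carrier (aut_group R)"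
    using V(1) unfolding permutation_topology_def openin_subtopology by blast
  have "id \<in> W" using V(2) W(2) by blast
  from product_topology_open_contains_basis[OF W(1) this]
  obtain X where X: "id \<in> (\<Pi>\<^sub>E i\<in>UNIV. X i)" "finite {i. X i \<noteq> UNIV}" "(\<Pi>\<^sub>E i\<in>UNIV. X i) \<subseteq> W"
    unfolding topspace_discrete_topology by blast
  have "pointwise_stabilizer R {i. X i \<noteq> UNIV} \<subseteq> V"
  proof
    fix v assume v: "v \<in> pointwise_stabilizer R {i. X i \<noteq> UNIV}"
    have "v i \<in> X i" for i
    proof (cases "X i = UNIV")
      case False
      then have "v i = id i" using v by (simp add: pointwise_stabilizer_def)
      then show ?thesis using PiE_mem[OF X(1), of i] by simp
    qed simp
    then have "v \<in> W" using X(3) by (auto simp: PiE_def)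
    then show "v \<in> V" using v W(2) by (simp add: pointwise_stabilizer_def)
  qed
  then show thesis using that X(2) by blast
qed

lemma id_in_pointwise_stabilizer: "id \<in> pointwise_stabilizer R F"
  by (simp add: pointwise_stabilizer_def id_in_aut_group)

lemma inv_in_pointwise_stabilizer:
  assumes "v \<in> pointwise_stabilizer R F"
  shows "inv v \<in> pointwise_stabilizer R F"
proof -
  have "bij v" using assms by (simp add: pointwise_stabilizer_def carrier_aut_group)
  then show ?thesis
    using assms aut_group_closed(2)[of v R] by (auto simp: pointwise_stabilizer_def) (metis bij_inv_eq_iff)
qed

lemma group_aut_group: "group (aut_group R)"
proof (rule groupI)
  fix g assume g: "g \<in> carrier (aut_group R)"
  then have "bij g" by (simp add: carrier_aut_group)
  then show "\<exists>h\<in>carrier (aut_group R). h \<otimes>\<^bsub>aut_group R\<^esub> g = \<one>\<^bsub>aut_group R\<^esub>"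
    using aut_group_closed(2)[OF g] by (intro bexI[of _ "inv g"]) (auto simp: bij_is_inj fun_eq_iff)
qed (auto simp: aut_group_closed id_in_aut_group o_assoc)

section \<open>An equivariant compactification in which arcs are clopen\<close>

text \<open>The Cantor cube with coordinates indexed by \<^typ>\<open>'p\<close>.\<close>

abbreviation truth_space :: "('p \<Rightarrow> bool) topology" where
  "truth_space \<equiv> product_topology (\<lambda>_. discrete_topology UNIV) UNIV"

lemma continuous_map_truth_space:
  assumes "\<And>p t. openin X {x \<in> topspace X. f x p = t}"
  shows "continuous_map X truth_space f"
  unfolding continuous_map_componentwise_UNIV
proof (intro allI)
  fix p
  have "openin X {x \<in> topspace X. f x p \<in> U}" for U
  proof -
    have "{x \<in> topspace X. f x p \<in> U} = (\<Union>t\<in>U. {x \<in> topspace X. f x p = t})" by blast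
    then show ?thesis using assms by auto
  qed
  then show "continuous_map X (discrete_topology UNIV) (\<lambda>x. f x p)"
    by (simp add: continuous_map_def)
qed

lemma openin_truth_space: "openin truth_space {k. k p = t}"
  using openin_continuous_map_preimage[OF continuous_map_product_coordinates[of p UNIV "\<lambda>_. discrete_topology UNIV"], of "{t}"]
  by simp

definition arc_code :: "('a \<Rightarrow> 'a \<Rightarrow> 'a \<Rightarrow> bool) \<Rightarrow> 'a \<Rightarrow> 'a \<times> 'a \<Rightarrow> bool" where
  "arc_code R x = (\<lambda>(a, b). x \<in> cyclic_arc R a b)"

definition arc_space :: "('a \<Rightarrow> 'a \<Rightarrow> 'a \<Rightarrow> bool) \<Rightarrow> ('a \<times> 'a \<Rightarrow> bool) topology" where
  "arc_space R = subtopology truth_space (truth_space closure_of range (arc_code R))"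

text \<open>An automorphism acts on codes by moving the coordinates, which on the code of a point agrees with
moving the point. The values outside the compactification are normalised because group actions are
homomorphisms into extensional bijections.\<close>

definition arc_action :: "('a \<Rightarrow> 'a \<Rightarrow> 'a \<Rightarrow> bool) \<Rightarrow> ('a \<Rightarrow> 'a) \<Rightarrow> ('a \<times> 'a \<Rightarrow> bool) \<Rightarrow> 'a \<times> 'a \<Rightarrow> bool" where
  "arc_action R g = (\<lambda>k\<in>topspace (arc_space R). k \<circ> map_prod (inv g) (inv g))"

lemma topspace_arc_space: "topspace (arc_space R) = truth_space closure_of range (arc_code R)"
  by (auto simp: arc_space_def)

lemma arc_code_in_arc_space: "arc_code R x \<in> topspace (arc_space R)"
  unfolding topspace_arc_space using closure_of_subset[of "range (arc_code R)" truth_space] by (auto simp: PiE_UNIV_domain)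

lemma arc_code_equivariant:
  assumes g: "g \<in> carrier (aut_group R)"
  shows "arc_code R x \<circ> map_prod (inv g) (inv g) = arc_code R (g x)"
proof -
  have "g (inv g y) = y" for y
    using g by (simp add: carrier_aut_group bij_is_surj surj_f_inv_f)
  then show ?thesis
    using cyclic_arc_image[OF g, of x "inv g _" "inv g _"] by (auto simp: arc_code_def fun_eq_iff)
qed

lemma arc_space_shift:
  assumes g: "g \<in> carrier (aut_group R)" and k: "k \<in> topspace (arc_space R)"
  shows "k \<circ> map_prod (inv g) (inv g) \<in> topspace (arc_space R)"
proof -
  have "continuous_map truth_space truth_space (\<lambda>k. k \<circ> map_prod (inv g) (inv g))"
    by (rule continuous_map_truth_space) (simp add: openin_truth_space)
  from continuous_map_image_closure_subset[OF this, of "range (arc_code R)"]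
  have "k \<circ> map_prod (inv g) (inv g) \<in> truth_space closure_of ((\<lambda>k. k \<circ> map_prod (inv g) (inv g)) ` range (arc_code R))"
    using k unfolding topspace_arc_space by blast
  also have "(\<lambda>k. k \<circ> map_prod (inv g) (inv g)) ` range (arc_code R) \<subseteq> range (arc_code R)"
    using arc_code_equivariant[OF g] by auto
  from closure_of_mono[OF this] have "truth_space closure_of ((\<lambda>k. k \<circ> map_prod (inv g) (inv g)) ` range (arc_code R))
      \<subseteq> topspace (arc_space R)"
    unfolding topspace_arc_space .
  finally show ?thesis .
qed

text \<open>Discreteness of the image of \<open>X\<close> comes from the degenerate arcs: the coordinate \<open>(y, y)\<close> singles out
the code of \<open>y\<close>.\<close>

lemma arc_space_is_compactification:
  "is_compactification (discrete_topology UNIV) (arc_space R, arc_code R)"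
  unfolding is_compactification_def fst_conv snd_conv
proof (intro conjI)
  have "compact_space (truth_space :: ('a \<times> 'a \<Rightarrow> bool) topology)"
    by (simp add: compact_space_product_topology compact_space_discrete_topology)
  then show "compact_space (arc_space R)"
    unfolding arc_space_def by (intro compact_space_subtopology closedin_compact_space) auto
  show "Hausdorff_space (arc_space R)"
    unfolding arc_space_def by (intro Hausdorff_space_subtopology) (simp add: Hausdorff_space_product_topology)
  show "arc_space R closure_of arc_code R ` topspace (discrete_topology UNIV) = topspace (arc_space R)"
    unfolding topspace_arc_space
    using closure_of_subset[of "range (arc_code R)" truth_space]
    by (simp add: arc_space_def closure_of_subtopology PiE_UNIV_domain inf.absorb2)
  have own: "arc_code R x (y, y) \<longleftrightarrow> x = y" for x y by (auto simp: arc_code_def cyclic_arc_def)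
  show "embedding_map (discrete_topology UNIV) (arc_space R) (arc_code R)"
    unfolding embedding_map_def
  proof (rule bijective_open_imp_homeomorphic_map)
    show "inj_on (arc_code R) (topspace (discrete_topology UNIV))"
      using own by (metis injI topspace_discrete_topology)
    show "open_map (discrete_topology UNIV) (subtopology (arc_space R) (arc_code R ` topspace (discrete_topology UNIV))) (arc_code R)"
      unfolding open_map_def
    proof (intro allI impI)
      fix A :: "'a set"
      have W: "openin truth_space (\<Union>y\<in>A. {k. k (y, y) = True})"
        by (rule openin_Union, erule imageE, simp only: openin_truth_space)
      have img: "arc_code R ` A = (\<Union>y\<in>A. {k. k (y, y) = True}) \<inter> range (arc_code R)"
        using own by auto
      have sub: "subtopology (arc_space R) (range (arc_code R)) = subtopology truth_space (range (arc_code R))"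
        using arc_code_in_arc_space[of R] unfolding topspace_arc_space
        by (simp add: arc_space_def subtopology_subtopology inf.absorb2 image_subset_iff)
      show "openin (subtopology (arc_space R) (arc_code R ` topspace (discrete_topology UNIV))) (arc_code R ` A)"
        unfolding topspace_discrete_topology sub img by (rule openin_subtopology_Int[OF W])
    qed
    show "arc_code R ` topspace (discrete_topology UNIV) = topspace (subtopology (arc_space R) (arc_code R ` topspace (discrete_topology UNIV)))"
      using arc_code_in_arc_space[of R] by auto
  qed (use arc_code_in_arc_space[of R] in auto)
qed

lemma arc_action_is_group_action: "group_action (aut_group R) (topspace (arc_space R)) (arc_action R)"
proof (intro group_action.intro group_hom.intro group_hom_axioms.intro homI)
  let ?E = "topspace (arc_space R)"
  show "group (aut_group R)" by (rule group_aut_group)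
  show "group (BijGroup ?E)" by (rule group_BijGroup)
  have maps: "arc_action R g k \<in> ?E" if "g \<in> carrier (aut_group R)" "k \<in> ?E" for g k
    using arc_space_shift[OF that] that by (simp add: arc_action_def)
  have comp: "arc_action R (g \<circ> h) k = arc_action R g (arc_action R h k)"
    if "g \<in> carrier (aut_group R)" "h \<in> carrier (aut_group R)" "k \<in> ?E" for g h k
    using that arc_space_shift[OF that(2,3)]
    by (simp add: arc_action_def o_inv_distrib carrier_aut_group map_prod_def fun_eq_iff split_beta)
  have one: "arc_action R id k = k" if "k \<in> ?E" for k
    using that by (simp add: arc_action_def map_prod.id)
  have bij: "arc_action R g \<in> Bij ?E" if g: "g \<in> carrier (aut_group R)" for g
  proof -
    have gi: "inv g \<in> carrier (aut_group R)" and "bij g"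
      using g aut_group_closed(2)[OF g] by (simp_all add: carrier_aut_group)
    then have "g \<circ> inv g = id" "inv g \<circ> g = id"
      by (simp_all add: bij_is_inj bij_is_surj flip: surj_iff)
    then have "arc_action R (inv g) (arc_action R g k) = k" "arc_action R g (arc_action R (inv g) k) = k"
      if "k \<in> ?E" for k
      using comp[OF gi g that] comp[OF g gi that] one[OF that] by simp_all
    then have "bij_betw (arc_action R g) ?E ?E"
      using maps[OF g] maps[OF gi] by (intro bij_betwI[of _ _ _ "arc_action R (inv g)"]) auto
    then show ?thesis by (simp add: Bij_def arc_action_def)
  qed
  show "arc_action R g \<in> carrier (BijGroup ?E)" if "g \<in> carrier (aut_group R)" for g
    using bij[OF that] by (simp add: BijGroup_def)
  show "arc_action R (g \<otimes>\<^bsub>aut_group R\<^esub> h) = arc_action R g \<otimes>\<^bsub>BijGroup ?E\<^esub> arc_action R h"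
    if g: "g \<in> carrier (aut_group R)" and h: "h \<in> carrier (aut_group R)" for g h
  proof -
    have "arc_action R (g \<circ> h) k = compose ?E (arc_action R g) (arc_action R h) k" for k
      using comp[OF g h] by (cases "k \<in> ?E") (simp_all add: compose_def arc_action_def)
    then show ?thesis using bij g h by (simp add: BijGroup_def fun_eq_iff)
  qed
qed

text \<open>The coordinate \<open>p\<close> of the code \<open>g k\<close> is the coordinate \<open>g\<inverse> p\<close> of \<open>k\<close>, and \<open>g\<inverse> p\<close> depends locally
constantly on \<open>g\<close>.\<close>

lemma continuous_arc_action:
  fixes R :: "'a \<Rightarrow> 'a \<Rightarrow> 'a \<Rightarrow> bool"
  shows "continuous_map (prod_topology (permutation_topology R) (arc_space R)) (arc_space R) (\<lambda>(g, k). arc_action R g k)"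
proof -
  let ?P = "prod_topology (permutation_topology R) (arc_space R)"
  let ?G = "carrier (aut_group R)" and ?E = "topspace (arc_space R)"
  have "continuous_map ?P truth_space (\<lambda>(g, k). arc_action R g k)"
  proof (rule continuous_map_truth_space)
    fix p :: "'a \<times> 'a" and t
    have G: "openin (permutation_topology R) {g \<in> ?G. map_prod g g q = p}" for q
    proof -
      have "{g \<in> ?G. map_prod g g q = p} = {g \<in> ?G. g (fst q) \<in> {fst p}} \<inter> {g \<in> ?G. g (snd q) \<in> {snd p}}"
        by (auto simp: map_prod_def prod_eq_iff split_beta)
      then show ?thesis by (simp only:) (intro openin_Int openin_permutation_topology_point)
    qed
    have E: "openin (arc_space R) {k \<in> ?E. k q = t}" for q
    proof -
      have "{k \<in> ?E. k q = t} = {k. k q = t} \<inter> ?E" by blast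
      then show ?thesis
        using openin_subtopology_Int[OF openin_truth_space[of q t], of ?E]
        unfolding topspace_arc_space arc_space_def[symmetric] by simp
    qed
    have "openin ?P (\<Union>q. {g \<in> ?G. map_prod g g q = p} \<times> {k \<in> ?E. k q = t})"
    proof (rule openin_Union)
      fix W assume "W \<in> range (\<lambda>q. {g \<in> ?G. map_prod g g q = p} \<times> {k \<in> ?E. k q = t})"
      then obtain q where "W = {g \<in> ?G. map_prod g g q = p} \<times> {k \<in> ?E. k q = t}" by (rule rangeE)
      then show "openin ?P W" using G E openin_prod_Times_iff by blast
    qed
    moreover have "{x \<in> topspace ?P. (case x of (g, k) \<Rightarrow> arc_action R g k) p = t} =
        (\<Union>q. {g \<in> ?G. map_prod g g q = p} \<times> {k \<in> ?E. k q = t})"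
    proof -
      have inv: "map_prod g g q = p \<longleftrightarrow> q = map_prod (inv g) (inv g) p" if "g \<in> ?G" for g q
        using that bij_inv_eq_iff[of g] by (auto simp: carrier_aut_group map_prod_def prod_eq_iff split_beta)
      have swap: "(g, k) \<in> {x \<in> topspace ?P. (case x of (g, k) \<Rightarrow> arc_action R g k) p = t} \<longleftrightarrow>
          (g, k) \<in> (\<Union>q. {g \<in> ?G. map_prod g g q = p} \<times> {k \<in> ?E. k q = t})" for g k
        using inv[of g] by (cases "g \<in> ?G") (simp_all add: arc_action_def del: split_paired_Ex)
      show ?thesis by (intro equalityI subrelI) (simp_all only: swap)
    qed
    ultimately show "openin ?P {x \<in> topspace ?P. (case x of (g, k) \<Rightarrow> arc_action R g k) p = t}" by simp
  qed
  moreover have "(\<lambda>(g, k). arc_action R g k) ` topspace ?P \<subseteq> ?E"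
    using arc_space_shift by (auto simp: arc_action_def)
  ultimately show ?thesis
    using continuous_map_in_subtopology[of ?P truth_space ?E "\<lambda>(g, k). arc_action R g k"]
    unfolding topspace_arc_space arc_space_def[symmetric] by (simp add: image_subset_iff_funcset)
qed

lemma arc_space_is_equivariant_compactification:
  "is_equivariant_compactification (aut_group R) (permutation_topology R)
     (discrete_topology UNIV) (\<lambda>g. g) (arc_space R, arc_code R) (arc_action R)"
  unfolding is_equivariant_compactification_def continuous_action_def fst_conv snd_conv
proof (intro conjI ballI arc_space_is_compactification arc_action_is_group_action continuous_arc_action)
  show "arc_action R g (arc_code R x) = arc_code R (g x)" if "g \<in> carrier (aut_group R)" for g x
    using arc_code_in_arc_space[of R x] arc_code_equivariant[OF that] by (simp add: arc_action_def)
qed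

lemma compactification_image:
  assumes "is_compactification Y b"
  shows "snd b ` topspace Y \<subseteq> topspace (fst b)"
proof -
  have "homeomorphic_map Y (subtopology (fst b) (snd b ` topspace Y)) (snd b)"
    using assms by (simp add: is_compactification_def embedding_map_def)
  from homeomorphic_imp_surjective_map[OF this] show ?thesis
    unfolding topspace_subtopology by blast
qed

text \<open>The sets \<open>P a b\<close> are pulled back from the coordinates of the cube along the map that maximality provides.\<close>

lemma maximal_compactification_separates_arcs:
  assumes max: "is_maximal_equivariant_compactification (aut_group R) (permutation_topology R)
    (discrete_topology UNIV) (\<lambda>g. g) \<beta> \<gamma>"
  obtains P where "\<And>a b. openin (fst \<beta>) (P a b)" "\<And>a b. closedin (fst \<beta>) (P a b)"
    "\<And>a b x. snd \<beta> x \<in> P a b \<longleftrightarrow> x \<in> cyclic_arc R a b"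
proof -
  obtain p where p: "continuous_map (fst \<beta>) (arc_space R) p" "\<And>x. p (snd \<beta> x) = arc_code R x"
    using maximal_equivariant_compactificationD[OF max arc_space_is_equivariant_compactification] by auto
  have "is_compactification (discrete_topology UNIV) \<beta>"
    using max unfolding is_maximal_equivariant_compactification_def is_equivariant_compactification_def by blast
  from compactification_image[OF this] have in_K: "snd \<beta> x \<in> topspace (fst \<beta>)" for x by auto
  have cont: "continuous_map (fst \<beta>) (discrete_topology UNIV) (\<lambda>k. p k q)" for q
    using p(1) unfolding arc_space_def continuous_map_in_subtopology continuous_map_componentwise_UNIV by blast
  define P where "P = (\<lambda>a b. {k \<in> topspace (fst \<beta>). p k (a, b) \<in> {True}})"
  show thesis
  proof
    show "openin (fst \<beta>) (P a b)" for a b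
      unfolding P_def by (rule openin_continuous_map_preimage[OF cont]) simp
    show "closedin (fst \<beta>) (P a b)" for a b
      unfolding P_def by (rule closedin_continuous_map_preimage[OF cont]) simp
    show "snd \<beta> x \<in> P a b \<longleftrightarrow> x \<in> cyclic_arc R a b" for a b x
      using p(2) in_K by (simp add: P_def arc_code_def)
  qed
qed

section \<open>The Roelcke uniformity and comparison of compactifications\<close>

text \<open>Every neighbourhood of the identity contains a pointwise stabilizer of a finite set, so the stabilizers
suffice to generate the uniformity; for them \<open>V g V\<close> is a double coset.\<close>

lemma eventually_roelcke_uniformity:
  "eventually Q (roelcke_uniformity (aut_group R) (permutation_topology R)) \<longleftrightarrow>
    (\<exists>F. finite F \<and> (\<forall>g\<in>carrier (aut_group R).
      \<forall>v\<in>pointwise_stabilizer R F. \<forall>w\<in>pointwise_stabilizer R F.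
      \<forall>v'\<in>pointwise_stabilizer R F. \<forall>w'\<in>pointwise_stabilizer R F. Q (v \<circ> g \<circ> w, v' \<circ> g \<circ> w')))"
proof -
  let ?G = "aut_group R" and ?T = "permutation_topology R"
  let ?B = "{V. openin ?T V \<and> \<one>\<^bsub>?G\<^esub> \<in> V}"
  define E where "E = (\<lambda>V. \<Union>g\<in>carrier ?G. (V #>\<^bsub>?G\<^esub> g <#>\<^bsub>?G\<^esub> V) \<times> (V #>\<^bsub>?G\<^esub> g <#>\<^bsub>?G\<^esub> V))"
  have coset: "V #>\<^bsub>?G\<^esub> g <#>\<^bsub>?G\<^esub> V = {v \<circ> g \<circ> w | v w. v \<in> V \<and> w \<in> V}" for V g
    by (auto simp: set_mult_def r_coset_def)
  have E: "p \<in> E V \<longleftrightarrow> (\<exists>g\<in>carrier ?G. \<exists>v\<in>V. \<exists>w\<in>V. \<exists>v'\<in>V. \<exists>w'\<in>V. p = (v \<circ> g \<circ> w, v' \<circ> g \<circ> w'))" for p V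
    unfolding E_def coset by blast
  have mono: "E V \<subseteq> E W" if "V \<subseteq> W" for V W
    using that unfolding subset_iff E by meson
  have "eventually Q (INF V\<in>?B. principal (E V)) \<longleftrightarrow> (\<exists>V\<in>?B. eventually Q (principal (E V)))"
  proof (rule eventually_INF_base)
    have "carrier ?G \<in> ?B"
      using openin_topspace[of ?T] id_in_aut_group[of R] by simp
    then show "?B \<noteq> {}" by blast
    fix V W assume "V \<in> ?B" "W \<in> ?B"
    then have "V \<inter> W \<in> ?B" by (simp add: openin_Int)
    moreover have "principal (E (V \<inter> W)) \<le> inf (principal (E V)) (principal (E W))"
      using mono[of "V \<inter> W" V] mono[of "V \<inter> W" W] by simp
    ultimately show "\<exists>X\<in>?B. principal (E X) \<le> inf (principal (E V)) (principal (E W))" by blast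
  qed
  then have "eventually Q (roelcke_uniformity ?G ?T) \<longleftrightarrow> (\<exists>V\<in>?B. \<forall>p\<in>E V. Q p)"
    unfolding roelcke_uniformity_def E_def eventually_principal .
  also have "\<dots> \<longleftrightarrow> (\<exists>F. finite F \<and> (\<forall>p\<in>E (pointwise_stabilizer R F). Q p))"
  proof
    assume "\<exists>V\<in>?B. \<forall>p\<in>E V. Q p"
    then obtain V where V: "openin ?T V" "id \<in> V" "\<forall>p\<in>E V. Q p" by auto
    obtain F where F: "finite F" "pointwise_stabilizer R F \<subseteq> V"
      using pointwise_stabilizer_in_nhd[OF V(1,2)] .
    then show "\<exists>F. finite F \<and> (\<forall>p\<in>E (pointwise_stabilizer R F). Q p)"
      using mono[OF F(2)] V(3) by blast
  next
    assume "\<exists>F. finite F \<and> (\<forall>p\<in>E (pointwise_stabilizer R F). Q p)"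
    then obtain F where F: "finite F" "\<forall>p\<in>E (pointwise_stabilizer R F). Q p" by blast
    then have "pointwise_stabilizer R F \<in> ?B"
      using openin_pointwise_stabilizer[OF F(1), of R] id_in_pointwise_stabilizer[of R F] by simp
    then show "\<exists>V\<in>?B. \<forall>p\<in>E V. Q p" using F(2) by blast
  qed
  finally have main: "eventually Q (roelcke_uniformity ?G ?T) \<longleftrightarrow>
    (\<exists>F. finite F \<and> (\<forall>p\<in>E (pointwise_stabilizer R F). Q p))" .
  have "(\<forall>p\<in>E V. Q p) \<longleftrightarrow> (\<forall>g\<in>carrier ?G. \<forall>v\<in>V. \<forall>w\<in>V. \<forall>v'\<in>V. \<forall>w'\<in>V. Q (v \<circ> g \<circ> w, v' \<circ> g \<circ> w'))" for V
    unfolding Ball_def[of "E V"] E by blast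
  then show ?thesis unfolding main by (simp only:)
qed

lemma clopen_family_neighbourhood:
  assumes "finite I" "\<And>i. i \<in> I \<Longrightarrow> openin X (H i)" "\<And>i. i \<in> I \<Longrightarrow> closedin X (H i)" "x \<in> topspace X"
  shows "\<exists>N. openin X N \<and> x \<in> N \<and> (\<forall>i\<in>I. \<forall>y\<in>N. y \<in> H i \<longleftrightarrow> x \<in> H i)"
  using assms(1-3)
proof (induction I rule: finite_induct)
  case empty
  then show ?case using assms(4) by (intro exI[of _ "topspace X"]) simp
next
  case (insert i I)
  from insert.IH[OF insert.prems(1,2)[OF insertI2]]
  obtain N where N: "openin X N" "x \<in> N" "\<forall>i\<in>I. \<forall>y\<in>N. y \<in> H i \<longleftrightarrow> x \<in> H i" by blast
  show ?case
  proof (cases "x \<in> H i")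
    case True
    then show ?thesis
      using N openin_Int[OF N(1) insert.prems(1)[OF insertI1]] by (intro exI[of _ "N \<inter> H i"]) blast
  next
    case False
    then show ?thesis
      using N openin_diff[OF N(1) insert.prems(2)[OF insertI1]] by (intro exI[of _ "N - H i"]) blast
  qed
qed

text \<open>The sets \<open>{g. g x = y}\<close> form a subbase of the permutation topology, so it is enough that they are traces
of open sets.\<close>

lemma embedding_map_permutation_topology:
  assumes f: "continuous_map (permutation_topology R) X f"
    and H: "\<And>x y. openin X (H x y)"
    and fH: "\<And>g x y. g \<in> carrier (aut_group R) \<Longrightarrow> f g \<in> H x y \<longleftrightarrow> g x = y"
  shows "embedding_map (permutation_topology R) X f"
proof -
  let ?G = "carrier (aut_group R)" and ?T = "permutation_topology R"
  have "inj_on f ?G"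
    using fH by (intro inj_onI) (metis ext)
  then obtain k where k: "\<And>g. g \<in> ?G \<Longrightarrow> k (f g) = g" by (metis inv_into_f_f)
  let ?Y = "subtopology X (f ` ?G)"
  have fX: "f ` ?G \<subseteq> topspace X" using continuous_map_image_subset_topspace[OF f] by simp
  have "continuous_map ?Y (product_topology (\<lambda>_. discrete_topology UNIV) UNIV) k"
    unfolding continuous_map_componentwise_UNIV
  proof (intro allI)
    fix x
    have "openin ?Y {C \<in> topspace ?Y. k C x \<in> A}" for A
    proof -
      have "openin X (\<Union>y\<in>A. H x y)" by (rule openin_Union) (use H in blast)
      moreover have "{C \<in> topspace ?Y. k C x \<in> A} = (\<Union>y\<in>A. H x y) \<inter> f ` ?G"
        using k fH fX by auto
      ultimately show ?thesis unfolding openin_subtopology by blast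
    qed
    then show "continuous_map ?Y (discrete_topology UNIV) (\<lambda>C. k C x)"
      by (simp add: continuous_map_def)
  qed
  then have "continuous_map ?Y ?T k"
    using k unfolding permutation_topology_def by (auto simp: continuous_map_in_subtopology)
  then have "homeomorphic_maps ?T ?Y f k"
    using f k fX by (auto simp: homeomorphic_maps_def continuous_map_in_subtopology)
  then show ?thesis
    unfolding embedding_map_def homeomorphic_map_maps by auto
qed

lemma equivalent_compactifications_via_homeomorphism:
  assumes L: "is_compactification Y (L, i)" and h: "homeomorphic_map L M h"
    and e: "\<And>y. y \<in> topspace Y \<Longrightarrow> h (i y) = e y"
  shows "equivalent_compactifications Y (M, e) (L, i)"
proof -
  have i: "i ` topspace Y \<subseteq> topspace L" using compactification_image[OF L] by simp
  have LM: "L homeomorphic_space M" using h by (rule homeomorphic_map_imp_homeomorphic_space)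
  have L': "compact_space L" "Hausdorff_space L" "embedding_map Y L i"
    "L closure_of (i ` topspace Y) = topspace L"
    using L by (auto simp: is_compactification_def)
  have he: "h ` i ` topspace Y = e ` topspace Y" using e by (force simp: image_iff)
  have "is_compactification Y (M, e)"
    unfolding is_compactification_def fst_conv snd_conv
  proof (intro conjI)
    show "compact_space M" "Hausdorff_space M"
      using L'(1,2) LM homeomorphic_compact_space homeomorphic_Hausdorff_space by blast+
    have "embedding_map Y M (h \<circ> i)"
      by (rule embedding_map_compose[OF L'(3)
            surjective_embedding_map[THEN iffD2, OF h, THEN conjunct1]])
    then show "embedding_map Y M e" by (rule embedding_map_eq) (simp add: e)
    show "M closure_of (e ` topspace Y) = topspace M"
      using homeomorphic_map_closure_of[OF h i] L'(4) homeomorphic_imp_surjective_map[OF h] he by simp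
  qed
  moreover obtain k where k: "homeomorphic_maps L M h k"
    using h unfolding homeomorphic_map_maps by blast
  then have "homeomorphic_map M L k"
    using homeomorphic_maps_sym homeomorphic_maps_map by metis
  moreover have "k (e y) = i y" if "y \<in> topspace Y" for y
    using k i e[OF that] that unfolding homeomorphic_maps_def by (metis image_subset_iff)
  ultimately show ?thesis
    unfolding equivalent_compactifications_def using L by auto
qed

section \<open>Graphs of a continuous action on a compact space\<close>

locale compact_aut_action =
  fixes R :: "'a \<Rightarrow> 'a \<Rightarrow> 'a \<Rightarrow> bool" and K :: "'k topology" and \<gamma> :: "('a \<Rightarrow> 'a) \<Rightarrow> 'k \<Rightarrow> 'k"
  assumes compact: "compact_space K" and Hausdorff: "Hausdorff_space K" and nonempty: "topspace K \<noteq> {}"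
    and action: "continuous_action (aut_group R) (permutation_topology R) K \<gamma>"
begin

abbreviation "G \<equiv> carrier (aut_group R)"
abbreviation "T \<equiv> permutation_topology R"
abbreviation "Z \<equiv> prod_topology K K"
abbreviation "hyper \<equiv> vietoris_topology Z"
abbreviation "graph \<equiv> action_graph K \<gamma>"

text \<open>Applied to a graph, the pair \<open>(w\<inverse>, v)\<close> turns \<open>g\<close> into \<open>v g w\<close>. This is how double cosets act on
the hyperspace.\<close>

definition pair_action :: "('a \<Rightarrow> 'a) \<times> ('a \<Rightarrow> 'a) \<Rightarrow> 'k \<times> 'k \<Rightarrow> 'k \<times> 'k" where
  "pair_action t = map_prod (\<gamma> (fst t)) (\<gamma> (snd t))"

lemma group_action: "group_action (aut_group R) (topspace K) \<gamma>"
  and continuous_action_map: "continuous_map (prod_topology T K) K (\<lambda>(g, x). \<gamma> g x)"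
  using action by (auto simp: continuous_action_def)

lemma action_in: "g \<in> G \<Longrightarrow> x \<in> topspace K \<Longrightarrow> \<gamma> g x \<in> topspace K"
  using group_action.element_image[OF group_action _ _ refl] .

lemma action_comp: "g \<in> G \<Longrightarrow> h \<in> G \<Longrightarrow> x \<in> topspace K \<Longrightarrow> \<gamma> (g \<circ> h) x = \<gamma> g (\<gamma> h x)"
  using group_action.composition_rule[OF group_action, of x g h] by simp

lemma action_id: "x \<in> topspace K \<Longrightarrow> \<gamma> id x = x"
  using group_action.id_eq_one[OF group_action] by (metis one_aut_group restrict_apply')

lemma continuous_map_action: "g \<in> G \<Longrightarrow> continuous_map K K (\<gamma> g)"
  using continuous_map_compose[OF _ continuous_action_map, of K "\<lambda>x. (g, x)"]
  by (simp add: o_def continuous_map_pairedI)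

lemma Z: "compact_space Z" "Hausdorff_space Z"
  using compact Hausdorff by (simp_all add: compact_space_prod_topology Hausdorff_space_prod_topology)

lemma hyper: "compact_space hyper" "Hausdorff_space hyper"
  using compact_space_vietoris Hausdorff_space_vietoris Z by auto

lemma graph_eq: "graph g = (\<lambda>x. (x, \<gamma> g x)) ` topspace K"
  by (auto simp: action_graph_def)

lemma graph_in_hyper: "g \<in> G \<Longrightarrow> graph g \<in> nonempty_closed_sets Z"
proof -
  assume "g \<in> G"
  then have "continuous_map K Z (\<lambda>x. (x, \<gamma> g x))"
    using continuous_map_action by (intro continuous_map_pairedI) auto
  then have "compactin Z (graph g)"
    unfolding graph_eq using compact by (intro image_compactin) (auto simp: compact_space_def)
  then have "closedin Z (graph g)" by (rule compactin_imp_closedin[OF Z(2)])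
  then show ?thesis using nonempty by (simp add: nonempty_closed_sets_def graph_eq)
qed

lemma pair_action_graph:
  assumes g: "g \<in> G" and v: "v \<in> G" and w: "w \<in> G"
  shows "pair_action (inv w, v) ` graph g = graph (v \<circ> g \<circ> w)"
proof -
  have wi: "inv w \<in> G" "inv w \<circ> w = id"
    using w aut_group_closed(2)[of w R] by (auto simp: carrier_aut_group bij_is_inj)
  have "pair_action (inv w, v) ` graph g = pair_action (inv w, v) ` (\<lambda>x. (x, \<gamma> g x)) ` \<gamma> w ` topspace K"
    using group_action.surj_prop[OF group_action w] by (simp add: graph_eq)
  also have "\<dots> = (\<lambda>x. (\<gamma> (inv w) (\<gamma> w x), \<gamma> v (\<gamma> g (\<gamma> w x)))) ` topspace K"
    by (simp add: image_image pair_action_def)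
  also have "\<dots> = (\<lambda>x. (x, \<gamma> (v \<circ> g \<circ> w) x)) ` topspace K"
  proof (rule image_cong[OF refl])
    fix x assume x: "x \<in> topspace K"
    have "\<gamma> (inv w) (\<gamma> w x) = x" using action_comp[OF wi(1) w x] wi(2) action_id[OF x] by simp
    moreover have "\<gamma> v (\<gamma> g (\<gamma> w x)) = \<gamma> (v \<circ> g \<circ> w) x"
      using action_comp[OF v g action_in[OF w x]] action_comp[OF aut_group_closed(1)[OF v g] w x] by simp
    ultimately show "(\<gamma> (inv w) (\<gamma> w x), \<gamma> v (\<gamma> g (\<gamma> w x))) = (x, \<gamma> (v \<circ> g \<circ> w) x)" by simp
  qed
  finally show ?thesis by (simp add: graph_eq)
qed

lemma continuous_pair_action_image:
  "continuous_map (prod_topology (prod_topology T T) hyper) hyper (\<lambda>(t, C). pair_action t ` C)"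
proof (rule continuous_map_vietoris_image[OF Z])
  let ?P = "prod_topology (prod_topology T T) Z"
  have 1: "continuous_map ?P (prod_topology T K) (\<lambda>p. (fst (fst p), fst (snd p)))"
    and 2: "continuous_map ?P (prod_topology T K) (\<lambda>p. (snd (fst p), snd (snd p)))"
    using continuous_map_fst[of "prod_topology T T" Z] continuous_map_snd[of "prod_topology T T" Z]
    by (auto intro!: continuous_map_pairedI dest: continuous_map_fst_of continuous_map_snd_of simp: o_def)
  show "continuous_map ?P Z (\<lambda>(t, z). pair_action t z)"
    using continuous_map_pairedI[OF continuous_map_compose[OF 1 continuous_action_map]
        continuous_map_compose[OF 2 continuous_action_map]]
    by (simp add: pair_action_def o_def case_prod_unfold map_prod_def)
qed

text \<open>The graph of \<open>g\<close> is the image of the diagonal under the pair \<open>(id, g)\<close>.\<close>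

lemma continuous_graph: "continuous_map T hyper graph"
proof -
  have "continuous_map T (prod_topology (prod_topology T T) hyper) (\<lambda>g. ((id, g), graph id))"
    using graph_in_hyper id_in_aut_group by (intro continuous_map_pairedI) auto
  from continuous_map_compose[OF this continuous_pair_action_image] show ?thesis
    by (rule continuous_map_eq) (use pair_action_graph[OF id_in_aut_group _ id_in_aut_group] in auto)
qed

text \<open>The tube lemma over the compact hyperspace makes the neighbourhood of the identity independent of
\<open>C\<close>.\<close>

lemma hyper_function_almost_invariant:
  assumes \<Phi>: "continuous_map hyper euclideanreal \<Phi>" and \<epsilon>: "0 < \<epsilon>"
  shows "\<exists>F. finite F \<and> (\<forall>v\<in>pointwise_stabilizer R F. \<forall>w\<in>pointwise_stabilizer R F.
    \<forall>C\<in>nonempty_closed_sets Z. dist (\<Phi> (pair_action (w, v) ` C)) (\<Phi> C) < \<epsilon>)"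
proof -
  let ?P = "prod_topology (prod_topology T T) hyper"
  define W where "W = {p \<in> topspace ?P. dist (\<Phi> (pair_action (fst p) ` snd p)) (\<Phi> (snd p)) < \<epsilon>}"
  have "continuous_map ?P euclideanreal (\<lambda>p. dist (\<Phi> (pair_action (fst p) ` snd p)) (\<Phi> (snd p)))"
    unfolding dist_real_def
    using continuous_map_compose[OF continuous_pair_action_image \<Phi>]
      continuous_map_compose[OF continuous_map_snd \<Phi>, of "prod_topology T T"]
    by (intro continuous_map_real_abs continuous_map_diff) (auto simp: o_def case_prod_unfold)
  from openin_continuous_map_preimage[OF this, of "{..<\<epsilon>}"]
  have W: "openin ?P W" by (simp add: W_def)
  have id: "pair_action (id, id) ` C = C" if "C \<in> nonempty_closed_sets Z" for C
  proof -
    have "C \<subseteq> topspace K \<times> topspace K"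
      using that closedin_subset[of Z C] by (auto simp: nonempty_closed_sets_def)
    then have "pair_action (id, id) z = z" if "z \<in> C" for z
      using that action_id by (auto simp: pair_action_def)
    then show ?thesis by simp
  qed
  have "{(id, id)} \<times> topspace hyper \<subseteq> W"
    using id id_in_aut_group \<epsilon> by (auto simp: W_def)
  from tube_lemma_right[OF W _ _ this]
  obtain U V where U: "openin (prod_topology T T) U" "(id, id) \<in> U" "topspace hyper \<subseteq> V" "U \<times> V \<subseteq> W"
    using hyper(1) id_in_aut_group by (auto simp: compact_space_def)
  from U(1)[unfolded openin_prod_topology_alt, rule_format, OF U(2)]
  obtain U1 U2 where U12: "openin T U1" "openin T U2" "id \<in> U1" "id \<in> U2" "U1 \<times> U2 \<subseteq> U" by blast
  obtain F1 where F1: "finite F1" "pointwise_stabilizer R F1 \<subseteq> U1"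
    using pointwise_stabilizer_in_nhd[OF U12(1,3)] .
  obtain F2 where F2: "finite F2" "pointwise_stabilizer R F2 \<subseteq> U2"
    using pointwise_stabilizer_in_nhd[OF U12(2,4)] .
  show ?thesis
  proof (intro exI conjI ballI)
    show "finite (F1 \<union> F2)" using F1 F2 by simp
    fix v w C assume v: "v \<in> pointwise_stabilizer R (F1 \<union> F2)" and w: "w \<in> pointwise_stabilizer R (F1 \<union> F2)"
      and C: "C \<in> nonempty_closed_sets Z"
    have "w \<in> U1" "v \<in> U2" using v w F1(2) F2(2) by (auto simp: pointwise_stabilizer_def)
    then have "((w, v), C) \<in> U \<times> V" using C U12(5) U(3) by auto
    then have "((w, v), C) \<in> W" using U(4) by (rule subsetD[rotated])
    then show "dist (\<Phi> (pair_action (w, v) ` C)) (\<Phi> C) < \<epsilon>" by (simp add: W_def)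
  qed
qed

text \<open>Two elements of one double coset of \<open>V\<close> have graphs that differ from a common graph only by the action
of pairs from \<open>V \<times> V\<close>, which almost fixes \<open>\<Phi>\<close>.\<close>

lemma hyper_function_roelcke_uniformly_continuous:
  assumes \<Phi>: "continuous_map hyper euclideanreal \<Phi>" and \<epsilon>: "0 < \<epsilon>"
  shows "eventually (\<lambda>(s, t). dist (\<Phi> (graph s)) (\<Phi> (graph t)) < \<epsilon>) (roelcke_uniformity (aut_group R) T)"
proof -
  obtain F where F: "finite F" "\<forall>v\<in>pointwise_stabilizer R F. \<forall>w\<in>pointwise_stabilizer R F.
      \<forall>C\<in>nonempty_closed_sets Z. dist (\<Phi> (pair_action (w, v) ` C)) (\<Phi> C) < \<epsilon>/2"
    using hyper_function_almost_invariant[OF \<Phi> half_gt_zero[OF \<epsilon>]] by blast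
  have near: "dist (\<Phi> (graph (v \<circ> g \<circ> w))) (\<Phi> (graph g)) < \<epsilon>/2"
    if "g \<in> G" "v \<in> pointwise_stabilizer R F" "w \<in> pointwise_stabilizer R F" for g v w
    using F(2)[rule_format, OF that(2) inv_in_pointwise_stabilizer[OF that(3)] graph_in_hyper[OF that(1)]]
      pair_action_graph[of g v w] that by (simp add: pointwise_stabilizer_def)
  show ?thesis
    unfolding eventually_roelcke_uniformity using F(1) dist_triangle_half_l[OF near near]
    by (intro exI[of _ F]) auto
qed

end

section \<open>Arcs recognise double cosets in the graph compactification\<close>

text \<open>Here \<open>\<iota>\<close> is an equivariant map of \<open>X\<close> onto a dense subset of \<open>K\<close>. By density the clopen set \<open>P a b\<close> is the
closure of the arc from \<open>a\<close> to \<open>b\<close>.\<close>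

locale arc_separating_action = compact_aut_action +
  fixes \<iota> :: "'a \<Rightarrow> 'b" and P :: "'a \<Rightarrow> 'a \<Rightarrow> 'b set"
  assumes dense: "K closure_of range \<iota> = topspace K"
    and equivariant: "\<And>g x. g \<in> G \<Longrightarrow> \<gamma> g (\<iota> x) = \<iota> (g x)"
    and arcs: "\<And>a b. openin K (P a b)" "\<And>a b. closedin K (P a b)" "\<And>a b x. \<iota> x \<in> P a b \<longleftrightarrow> x \<in> cyclic_arc R a b"
begin

text \<open>These clopen subsets of the hyperspace record, for a graph, whether a point of one arc is moved into another arc.\<close>

definition hits :: "('a \<times> 'a) \<times> 'a \<times> 'a \<Rightarrow> ('b \<times> 'b) set set" where
  "hits = (\<lambda>((a, b), (c, d)). {C \<in> nonempty_closed_sets Z. C \<inter> (P a b \<times> P c d) \<noteq> {}})"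

lemma \<iota>_in: "\<iota> x \<in> topspace K"
  using arcs(3)[of x x x] openin_subset[OF arcs(1)[of x x]] by (auto simp: cyclic_arc_def)

lemma clopen_hits: "openin hyper (hits q)" "closedin hyper (hits q)"
proof -
  obtain a b c d where q: "q = ((a, b), (c, d))" by (metis surj_pair)
  have "openin Z (P a b \<times> P c d)" "closedin Z (P a b \<times> P c d)"
    using arcs by (simp_all add: openin_prod_Times_iff closedin_prod_Times_iff)
  then show "openin hyper (hits q)" "closedin hyper (hits q)"
    by (simp_all add: q hits_def openin_vietoris_hit closedin_vietoris_hit)
qed

text \<open>The points of \<open>K\<close> in \<open>P a b\<close> that \<open>g\<close> moves into \<open>P c d\<close> form an open set, so if there is one, then
there is one in the dense image of \<open>X\<close>.\<close>

lemma graph_in_hits_iff: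
  assumes g: "g \<in> G"
  shows "graph g \<in> hits ((a, b), (c, d)) \<longleftrightarrow> (\<exists>x\<in>cyclic_arc R a b. g x \<in> cyclic_arc R c d)"
proof -
  define O' where "O' = P a b \<inter> {k \<in> topspace K. \<gamma> g k \<in> P c d}"
  have "openin K O'"
    unfolding O'_def by (intro openin_Int arcs(1) openin_continuous_map_preimage[OF continuous_map_action[OF g]])
  then have "O' \<noteq> {} \<longleftrightarrow> (\<exists>x. \<iota> x \<in> O')"
    using dense openin_subset[of K O'] unfolding dense_intersects_open by blast
  moreover have "graph g \<in> hits ((a, b), (c, d)) \<longleftrightarrow> O' \<noteq> {}"
    using graph_in_hyper[OF g] openin_subset[OF arcs(1)] by (auto simp: hits_def O'_def graph_eq)
  moreover have "\<iota> x \<in> O' \<longleftrightarrow> x \<in> cyclic_arc R a b \<and> g x \<in> cyclic_arc R c d" for x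
    using equivariant[OF g] \<iota>_in arcs(3) by (simp add: O'_def)
  ultimately show ?thesis by blast
qed

lemma embedding_graph: "embedding_map T hyper graph"
proof (rule embedding_map_permutation_topology[OF continuous_graph clopen_hits(1)])
  show "graph g \<in> hits ((x, x), (y, y)) \<longleftrightarrow> g x = y" if "g \<in> G" for g x y
    using graph_in_hits_iff[OF that] by (simp add: cyclic_arc_def)
qed

text \<open>Agreement with \<open>C\<close> on the finitely many clopen sets \<open>hits q\<close>, with \<open>q\<close> ranging over the arcs of \<open>F\<close>, prescribes
the whole arc pattern of \<open>g\<close>.\<close>

lemma double_coset_neighbourhood:
  assumes R: "cyclic_order R" "ultrahomogeneous R" and F: "finite F" and C: "C \<in> topspace hyper"
  shows "\<exists>N. openin hyper N \<and> C \<in> N \<and> (\<forall>s\<in>G. \<forall>t\<in>G. graph s \<in> N \<longrightarrow> graph t \<in> N \<longrightarrow>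
    (\<exists>v\<in>pointwise_stabilizer R F. \<exists>w\<in>pointwise_stabilizer R F. t = v \<circ> s \<circ> w))"
proof -
  have "finite ((F \<times> F) \<times> (F \<times> F))" using F by simp
  from clopen_family_neighbourhood[where H = hits, OF this clopen_hits C]
  obtain N where N: "openin hyper N" "C \<in> N" "\<forall>q\<in>(F \<times> F) \<times> (F \<times> F). \<forall>D\<in>N. D \<in> hits q \<longleftrightarrow> C \<in> hits q"
    by (elim exE conjE) (rule that; assumption)
  show ?thesis
  proof (intro exI[of _ N] conjI ballI impI N(1,2))
    fix s t assume st: "s \<in> G" "t \<in> G" "graph s \<in> N" "graph t \<in> N"
    have "(\<exists>x\<in>cyclic_arc R a b. s x \<in> cyclic_arc R c d) \<longleftrightarrow> (\<exists>x\<in>cyclic_arc R a b. t x \<in> cyclic_arc R c d)"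
      if "a \<in> F" "b \<in> F" "c \<in> F" "d \<in> F" for a b c d
    proof -
      have q: "((a, b), (c, d)) \<in> (F \<times> F) \<times> (F \<times> F)" using that by simp
      show ?thesis
        unfolding graph_in_hits_iff[OF st(1), symmetric] graph_in_hits_iff[OF st(2), symmetric]
        using N(3)[rule_format, OF q st(3)] N(3)[rule_format, OF q st(4)] by blast
    qed
    from arc_pattern_determines_double_coset[OF R F st(1,2) this]
    show "\<exists>v\<in>pointwise_stabilizer R F. \<exists>w\<in>pointwise_stabilizer R F. t = v \<circ> s \<circ> w" .
  qed
qed

text \<open>The recognition criterion for Samuel compactifications applies to the closure of the graphs: double
coset neighbourhoods bound the oscillation, and Urysohn functions on the whole hyperspace separate
points.\<close>

theorem roelcke_equivalent_graph_compactification: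
  assumes R: "cyclic_order R" "ultrahomogeneous R"
  shows "equivalent_compactifications T (roelcke_compactification (aut_group R) T)
    (graph_compactification (aut_group R) K \<gamma>)"
proof -
  define U where "U = roelcke_uniformity (aut_group R) T"
  define L where "L = subtopology hyper (hyper closure_of (graph ` G))"
  have graphL: "graph ` G \<subseteq> hyper closure_of (graph ` G)"
    using graph_in_hyper by (intro closure_of_subset) auto
  have topL: "topspace L = hyper closure_of (graph ` G)"
    unfolding L_def topspace_subtopology by (rule inf.absorb2) (rule closure_of_subset_topspace)
  have L: "compact_space L" "Hausdorff_space L"
    using hyper closedin_compact_space[OF hyper(1) closedin_closure_of]
    by (auto simp: L_def compact_space_subtopology Hausdorff_space_subtopology)
  have denseL: "L closure_of (graph ` G) = topspace L"
    unfolding topL using graphL by (simp add: L_def closure_of_subtopology inf.absorb2)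
  have L_hyper: "C \<in> topspace hyper" if "C \<in> topspace L" for C
    using that unfolding L_def topspace_subtopology by blast

  have osc: "\<exists>N. openin L N \<and> C \<in> N \<and>
      (\<forall>s\<in>G. \<forall>t\<in>G. graph s \<in> N \<longrightarrow> graph t \<in> N \<longrightarrow> dist (f s) (f t) < \<epsilon>)"
    if f: "f \<in> bounded_unif_cont G U" and C: "C \<in> topspace L" and \<epsilon>: "0 < \<epsilon>" for f C \<epsilon>
  proof -
    have "eventually (\<lambda>(s, t). dist (f s) (f t) < \<epsilon>) U"
      using f \<epsilon> unfolding mem_bounded_unif_cont_iff by blast
    then obtain F where F: "finite F" and
      small: "\<forall>g\<in>G. \<forall>v\<in>pointwise_stabilizer R F. \<forall>w\<in>pointwise_stabilizer R F.
        \<forall>v'\<in>pointwise_stabilizer R F. \<forall>w'\<in>pointwise_stabilizer R F. dist (f (v \<circ> g \<circ> w)) (f (v' \<circ> g \<circ> w')) < \<epsilon>"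
      unfolding U_def eventually_roelcke_uniformity by auto
    obtain N where N: "openin hyper N" "C \<in> N"
      "\<forall>s\<in>G. \<forall>t\<in>G. graph s \<in> N \<longrightarrow> graph t \<in> N \<longrightarrow>
        (\<exists>v\<in>pointwise_stabilizer R F. \<exists>w\<in>pointwise_stabilizer R F. t = v \<circ> s \<circ> w)"
      using double_coset_neighbourhood[OF R F L_hyper[OF C]] by (elim exE conjE) (rule that; assumption)
    have "dist (f s) (f t) < \<epsilon>" if st: "s \<in> G" "t \<in> G" "graph s \<in> N" "graph t \<in> N" for s t
    proof -
      obtain v w where "v \<in> pointwise_stabilizer R F" "w \<in> pointwise_stabilizer R F" "t = v \<circ> s \<circ> w"
        using N(3)[rule_format, OF st] by blast
      then show ?thesis
        using small[rule_format, OF st(1) id_in_pointwise_stabilizer id_in_pointwise_stabilizer, of v w] by simp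
    qed
    moreover have "openin L (N \<inter> topspace L)"
      using openin_subtopology_Int[OF N(1), of "topspace L"] unfolding topL L_def[symmetric] .
    ultimately show ?thesis using N(2) C by (intro exI[of _ "N \<inter> topspace L"]) simp
  qed

  have sep: "\<exists>\<Phi>. continuous_map L euclideanreal \<Phi> \<and> \<Phi> C \<noteq> \<Phi> D \<and>
        (\<forall>\<epsilon>>0. eventually (\<lambda>(s, t). dist (\<Phi> (graph s)) (\<Phi> (graph t)) < \<epsilon>) U)"
    if CD: "C \<in> topspace L" "D \<in> topspace L" "C \<noteq> D" for C D
  proof -
    have "normal_space hyper" using hyper compact_Hausdorff_or_regular_imp_normal_space by blast
    from this[unfolded normal_space_iff_Urysohn_alt, rule_format, of "{C}" "{D}"]
    obtain \<Phi> where \<Phi>: "continuous_map hyper euclideanreal \<Phi>" "\<Phi> ` {C} \<subseteq> {0}" "\<Phi> ` {D} \<subseteq> {1}"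
      using closedin_Hausdorff_singleton[OF hyper(2) L_hyper[OF CD(1)]]
        closedin_Hausdorff_singleton[OF hyper(2) L_hyper[OF CD(2)]] CD(3) by auto
    have "continuous_map L euclideanreal \<Phi>"
      unfolding L_def by (rule continuous_map_from_subtopology[OF \<Phi>(1)])
    then show ?thesis
      using hyper_function_roelcke_uniformly_continuous[OF \<Phi>(1)] \<Phi>(2,3)
      unfolding U_def by (intro exI[of _ \<Phi>]) simp
  qed

  have U_le: "U \<le> principal (G \<times> G)"
    unfolding le_principal U_def eventually_roelcke_uniformity
    by (intro exI[of _ "{}"]) (auto simp: pointwise_stabilizer_def aut_group_closed)
  have "G \<noteq> {}" using id_in_aut_group by blast
  moreover have "graph ` G \<subseteq> topspace L" using graphL topL by simp
  ultimately obtain h where h: "homeomorphic_map L (fst (samuel_compactification G U)) h"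
      "\<And>s. s \<in> G \<Longrightarrow> h (graph s) = snd (samuel_compactification G U) s"
    using homeomorphic_map_samuel_compactification[OF U_le _ L _ denseL osc sep] by blast

  have "embedding_map T L graph"
    using embedding_graph graphL by (simp add: L_def embedding_map_in_subtopology)
  then have "is_compactification T (L, graph)"
    using L denseL by (simp add: is_compactification_def)
  from equivalent_compactifications_via_homeomorphism[OF this h(1), of "snd (samuel_compactification G U)"]
  have "equivalent_compactifications T (samuel_compactification G U) (L, graph)"
    using h(2) by simp
  then show ?thesis
    by (simp add: roelcke_compactification_def graph_compactification_def L_def U_def Let_def)
qed

end

theorem theorem1:
  fixes R :: "'a \<Rightarrow> 'a \<Rightarrow> 'a \<Rightarrow> bool"
    and \<beta> :: "'k topology \<times> ('a \<Rightarrow> 'k)"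
    and \<gamma> :: "('a \<Rightarrow> 'a) \<Rightarrow> 'k \<Rightarrow> 'k"
  assumes "cyclic_order R"
    and "infinite (UNIV :: 'a set)"
    and "ultrahomogeneous R"
    and "is_maximal_equivariant_compactification (aut_group R) (permutation_topology R)
           (discrete_topology UNIV) (\<lambda>g. g) \<beta> \<gamma>"
  shows "equivalent_compactifications (permutation_topology R)
           (roelcke_compactification (aut_group R) (permutation_topology R))
           (graph_compactification (aut_group R) (fst \<beta>) \<gamma>)"
proof -
  have comp: "is_compactification (discrete_topology UNIV) \<beta>"
    and act: "continuous_action (aut_group R) (permutation_topology R) (fst \<beta>) \<gamma>"
    and equi: "\<forall>g\<in>carrier (aut_group R). \<forall>x\<in>topspace (discrete_topology UNIV). \<gamma> g (snd \<beta> x) = snd \<beta> (g x)"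
    using assms(4) unfolding is_maximal_equivariant_compactification_def is_equivariant_compactification_def
    by blast+
  obtain P where P: "\<And>a b. openin (fst \<beta>) (P a b)" "\<And>a b. closedin (fst \<beta>) (P a b)"
      "\<And>a b x. snd \<beta> x \<in> P a b \<longleftrightarrow> x \<in> cyclic_arc R a b"
    using maximal_compactification_separates_arcs[OF assms(4)] by blast
  interpret arc_separating_action R "fst \<beta>" \<gamma> "snd \<beta>" P
  proof
    show "compact_space (fst \<beta>)" "Hausdorff_space (fst \<beta>)" "fst \<beta> closure_of range (snd \<beta>) = topspace (fst \<beta>)"
      using comp by (simp_all add: is_compactification_def)
    show "topspace (fst \<beta>) \<noteq> {}" using compactification_image[OF comp] by auto
    show "\<gamma> g (snd \<beta> x) = snd \<beta> (g x)" if "g \<in> carrier (aut_group R)" for g x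
      using equi that by simp
  qed (rule act P)+
  show ?thesis by (rule roelcke_equivalent_graph_compactification[OF assms(1,3)])
qed

end
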